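(* Let $M$ be a sphere of revolution in $\mathrm{Nil}$. Then $E(M)\ge\pi$, and equality $E(M)=\pi$ holds if and only if $M$ is a constant mean curvature sphere.
   Context: $\mathrm{Nil}$ is the three-dimensional Heisenberg group of real upper triangular matrices $\begin{pmatrix}1&x&z\\0&1&y\\0&0&1\end{pmatrix}$ with the left-invariant Riemannian metric $ds^2=dx^2+dy^2+(dz-x\,dy)^2$. Let $e_1,e_2,e_3$ be the left-invariant orthonormal frame which at the identity equals $\partial_x,\partial_y,\partial_z$. Cylindrical coordinates $(\rho,\phi,h)$ on $\mathrm{Nil}$ are given by $x=\rho\cos\phi$, $y=\rho\sin\phi$, $z=\frac{\rho^2}{2}\cos\phi\sin\phi+h$; the metric becomes $d\rho^2-\rho^2\,dh\,d\phi+\frac14\rho^2(4+\rho^2)d\phi^2+dh^2$ and the rotations $\phi\mapsto\phi+\theta$ around the $z$-axis are isometries. A sphere of revolution is a smooth closed surface diffeomorphic to $S^2$ obtained by revolving a smooth curve around the $z$-axis (i.e. by applying all these rotations to it), or a left translate of such a surface in the group $\mathrm{Nil}$. For an oriented surface in $\mathrm{Nil}$ with unit normal $n$: $n_3=\langle n,e_3\rangle$, $H$ is the mean curvature (half the sum of the principal curvatures), $d\mu$ is the induced area measure, and for a closed oriented surface $M$ the spinor energy is $E(M)=\frac14\int_M\big(H^2-\frac{n_3^2}{4}\big)d\mu$. A constant mean curvature sphere is a sphere with $H=\mathrm{const}$. *)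

theory Defs
  imports "HOL-Analysis.Analysis"
begin

text \<open>On an open set: all iterated derivatives up to order \<open>n\<close> exist and are continuous.\<close>

primrec higher_differentiable_on ::
  "'a::real_normed_vector set \<Rightarrow> ('a \<Rightarrow> 'b::real_normed_vector) \<Rightarrow> nat \<Rightarrow> bool" where
  "higher_differentiable_on S f 0 \<longleftrightarrow> continuous_on S f"
| "higher_differentiable_on S f (Suc n) \<longleftrightarrow>
     (\<forall>x\<in>S. f differentiable (at x)) \<and>
     (\<forall>v. higher_differentiable_on S (\<lambda>x. frechet_derivative f (at x) v) n)"

text \<open>A map on an arbitrary subset of a vector space is smooth if it extends locally to
  a \<open>C\<^sup>\<infinity>\<close> map on an open set.\<close>

definition smooth_map ::
  "'a::real_normed_vector set \<Rightarrow> ('a \<Rightarrow> 'b::real_normed_vector) \<Rightarrow> bool" where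
  "smooth_map S f \<longleftrightarrow>
     (\<forall>p\<in>S. \<exists>U g. open U \<and> p \<in> U \<and> (\<forall>n. higher_differentiable_on U g n)
        \<and> (\<forall>x\<in>U \<inter> S. g x = f x))"

text \<open>The matrix with entries \<open>x, y, z\<close> is represented by the vector \<open>(x, y, z)\<close>.\<close>

definition nil_matrix :: "real^3 \<Rightarrow> real^3^3" where
  "nil_matrix a = vector [vector [1, a$1, a$3], vector [0, 1, a$2], vector [0, 0, 1]]"

definition nil_mult :: "real^3 \<Rightarrow> real^3 \<Rightarrow> real^3" where
  "nil_mult a b = vector [a$1 + b$1, a$2 + b$2, a$3 + b$3 + a$1 * b$2]"

lemma nil_matrix_mult: "nil_matrix (nil_mult a b) = nil_matrix a ** nil_matrix b"
  by (simp add: vec_eq_iff forall_3 nil_matrix_def nil_mult_def matrix_matrix_mult_def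
      sum_3 vector_3)

text \<open>The metric \<open>dx\<^sup>2 + dy\<^sup>2 + (dz - x dy)\<^sup>2\<close> at the point \<open>p\<close>; a tangent
  vector is given by its components with respect to \<open>\<partial>\<^sub>x, \<partial>\<^sub>y, \<partial>\<^sub>z\<close>.\<close>

definition nil_inner :: "real^3 \<Rightarrow> real^3 \<Rightarrow> real^3 \<Rightarrow> real" where
  "nil_inner p v w = v$1 * w$1 + v$2 * w$2 + (v$3 - p$1 * v$2) * (w$3 - p$1 * w$2)"

text \<open>The frame \<open>e\<^sub>1, e\<^sub>2, e\<^sub>3\<close>: the differential at the identity of the left translation by
  \<open>p\<close>, applied to the coordinate vectors.\<close>

definition nil_frame :: "3 \<Rightarrow> real^3 \<Rightarrow> real^3" where
  "nil_frame i p = frechet_derivative (nil_mult p) (at 0) (axis i 1)"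

definition cylindrical :: "real \<Rightarrow> real \<Rightarrow> real \<Rightarrow> real^3" where
  "cylindrical \<rho> \<phi> h =
     vector [\<rho> * cos \<phi>, \<rho> * sin \<phi>, \<rho>\<^sup>2 / 2 * cos \<phi> * sin \<phi> + h]"

text \<open>The rotation around the \<open>z\<close>-axis fixes \<open>h = z - x y / 2\<close>, not \<open>z\<close>.\<close>

definition nil_rotation :: "real \<Rightarrow> real^3 \<Rightarrow> real^3" where
  "nil_rotation \<theta> p =
     (let x = cos \<theta> * p$1 - sin \<theta> * p$2; y = sin \<theta> * p$1 + cos \<theta> * p$2
      in vector [x, y, p$3 - p$1 * p$2 / 2 + x * y / 2])"

lemma nil_rotation_cylindrical:
  "nil_rotation \<theta> (cylindrical \<rho> \<phi> h) = cylindrical \<rho> (\<phi> + \<theta>) h"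
  by (simp add: vec_eq_iff forall_3 nil_rotation_def cylindrical_def Let_def vector_3
      cos_add sin_add power2_eq_square field_simps)

definition metric_matrix ::
  "(real^'n \<Rightarrow> real^'n \<Rightarrow> real^'n \<Rightarrow> real) \<Rightarrow> real^'n \<Rightarrow> real^'n^'n" where
  "metric_matrix g p = (\<chi> i j. g p (axis i 1) (axis j 1))"

definition metric_partial ::
  "(real^'n \<Rightarrow> real^'n \<Rightarrow> real^'n \<Rightarrow> real) \<Rightarrow> real^'n \<Rightarrow> 'n \<Rightarrow> 'n \<Rightarrow> 'n \<Rightarrow> real" where
  "metric_partial g p l i j =
     frechet_derivative (\<lambda>q. metric_matrix g q $ i $ j) (at p) (axis l 1)"

definition christoffel ::
  "(real^'n \<Rightarrow> real^'n \<Rightarrow> real^'n \<Rightarrow> real) \<Rightarrow> real^'n \<Rightarrow> 'n \<Rightarrow> 'n \<Rightarrow> 'n \<Rightarrow> real" where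
  "christoffel g p k i j =
     (\<Sum>l\<in>UNIV. matrix_inv (metric_matrix g p) $ k $ l *
        (metric_partial g p i j l + metric_partial g p j i l - metric_partial g p l i j)) / 2"

text \<open>A surface is given by an immersion \<open>f\<close> of the unit sphere of \<open>\<real>\<^sup>3\<close>.\<close>

abbreviation S2 :: "(real^3) set" where
  "S2 \<equiv> sphere 0 1"

definition tangent_S2 :: "real^3 \<Rightarrow> (real^3) set" where
  "tangent_S2 p = {v. v \<bullet> p = 0}"

text \<open>The differential at \<open>p \<in> S2\<close> of a map on the sphere, applied to a tangent vector \<open>v\<close>,
  computed along the curve \<open>t \<mapsto> (p + t v) / |p + t v|\<close> in the sphere.\<close>

definition sphere_deriv :: "(real^3 \<Rightarrow> real^3) \<Rightarrow> real^3 \<Rightarrow> real^3 \<Rightarrow> real^3" where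
  "sphere_deriv f p v = vector_derivative (\<lambda>t. f (sgn (p + t *\<^sub>R v))) (at 0)"

definition immersed_sphere :: "(real^3 \<Rightarrow> real^3) \<Rightarrow> bool" where
  "immersed_sphere f \<longleftrightarrow>
     smooth_map S2 f \<and> (\<forall>p\<in>S2. inj_on (sphere_deriv f p) (tangent_S2 p))"

definition unit_normal :: "(real^3 \<Rightarrow> real^3) \<Rightarrow> (real^3 \<Rightarrow> real^3) \<Rightarrow> bool" where
  "unit_normal f n \<longleftrightarrow>
     smooth_map S2 n \<and>
     (\<forall>p\<in>S2. nil_inner (f p) (n p) (n p) = 1 \<and>
        (\<forall>v\<in>tangent_S2 p. nil_inner (f p) (n p) (sphere_deriv f p v) = 0))"

text \<open>The covariant derivative in Nil, in the direction \<open>v\<close>, of a vector field \<open>n\<close> along \<open>f\<close>.\<close>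

definition covariant_deriv ::
  "(real^3 \<Rightarrow> real^3) \<Rightarrow> (real^3 \<Rightarrow> real^3) \<Rightarrow> real^3 \<Rightarrow> real^3 \<Rightarrow> real^3" where
  "covariant_deriv f n p v =
     (\<chi> k. sphere_deriv n p v $ k +
        (\<Sum>i\<in>UNIV. \<Sum>j\<in>UNIV.
           christoffel nil_inner (f p) k i j * sphere_deriv f p v $ i * n p $ j))"

text \<open>\<open>k1\<close>, \<open>k2\<close> are the eigenvalues of the shape operator \<open>v \<mapsto> - \<nabla>\<^sub>v n\<close> at \<open>p\<close>, with
  eigenvectors \<open>v1\<close>, \<open>v2\<close> that are orthonormal in the induced metric.\<close>

definition principal_curvatures ::
  "(real^3 \<Rightarrow> real^3) \<Rightarrow> (real^3 \<Rightarrow> real^3) \<Rightarrow> real^3 \<Rightarrow> real \<Rightarrow> real \<Rightarrow> bool" where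
  "principal_curvatures f n p k1 k2 \<longleftrightarrow>
     (\<exists>v1\<in>tangent_S2 p. \<exists>v2\<in>tangent_S2 p.
        nil_inner (f p) (sphere_deriv f p v1) (sphere_deriv f p v1) = 1 \<and>
        nil_inner (f p) (sphere_deriv f p v2) (sphere_deriv f p v2) = 1 \<and>
        nil_inner (f p) (sphere_deriv f p v1) (sphere_deriv f p v2) = 0 \<and>
        - covariant_deriv f n p v1 = k1 *\<^sub>R sphere_deriv f p v1 \<and>
        - covariant_deriv f n p v2 = k2 *\<^sub>R sphere_deriv f p v2)"

definition mean_curvature ::
  "(real^3 \<Rightarrow> real^3) \<Rightarrow> (real^3 \<Rightarrow> real^3) \<Rightarrow> real^3 \<Rightarrow> real" where
  "mean_curvature f n p =
     (THE H. \<exists>k1 k2. principal_curvatures f n p k1 k2 \<and> H = (k1 + k2) / 2)"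

definition constant_mean_curvature ::
  "(real^3 \<Rightarrow> real^3) \<Rightarrow> (real^3 \<Rightarrow> real^3) \<Rightarrow> bool" where
  "constant_mean_curvature f n \<longleftrightarrow> (\<exists>c. \<forall>p\<in>S2. mean_curvature f n p = c)"

definition spherical :: "real \<Rightarrow> real \<Rightarrow> real^3" where
  "spherical s \<phi> = vector [sin s * cos \<phi>, sin s * sin \<phi>, cos s]"

text \<open>The area element \<open>\<surd>(E G - F\<^sup>2)\<close> in spherical coordinates.\<close>

definition area_density :: "(real^3 \<Rightarrow> real^3) \<Rightarrow> real \<Rightarrow> real \<Rightarrow> real" where
  "area_density f s \<phi> =
     (let a = vector_derivative (\<lambda>s'. f (spherical s' \<phi>)) (at s);
          b = vector_derivative (\<lambda>\<phi>'. f (spherical s \<phi>')) (at \<phi>);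
          g = nil_inner (f (spherical s \<phi>))
      in sqrt (g a a * g b b - (g a b)\<^sup>2))"

text \<open>The measure on the sphere induced by \<open>f\<close>. Spherical coordinates miss only a half great
  circle, which is a null set for the area.\<close>

definition area_measure :: "(real^3 \<Rightarrow> real^3) \<Rightarrow> (real^3) measure" where
  "area_measure f =
     distr
       (density (restrict_space lborel ({0<..<pi} \<times> {0<..<2 * pi}))
          (\<lambda>(s, \<phi>). ennreal (area_density f s \<phi>)))
       (restrict_space borel S2)
       (\<lambda>(s, \<phi>). spherical s \<phi>)"

definition spinor_energy :: "(real^3 \<Rightarrow> real^3) \<Rightarrow> (real^3 \<Rightarrow> real^3) \<Rightarrow> real" where
  "spinor_energy f n =
     1 / 4 * (LINT p|area_measure f.
        (mean_curvature f n p)\<^sup>2 - (nil_inner (f p) (n p) (nil_frame 3 (f p)))\<^sup>2 / 4)"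

text \<open>The sphere of revolution is parametrized so that the half great circle from pole to pole
  is sent to the generating curve \<open>c\<close> and each parallel to the orbit of a point of \<open>c\<close>.
  Left translates by group elements \<open>a\<close> are included.\<close>

definition sphere_of_revolution :: "(real^3 \<Rightarrow> real^3) \<Rightarrow> bool" where
  "sphere_of_revolution f \<longleftrightarrow>
     immersed_sphere f \<and>
     (\<exists>a c. smooth_map {0..pi} c \<and>
        (\<forall>s\<in>{0..pi}. \<forall>\<phi>. f (spherical s \<phi>) = nil_mult a (nil_rotation \<phi> (c s))))"

end

theory Submission
  imports Defs
begin

text \<open>Away from its two poles a sphere of revolution is described by two functions along the
  generating curve: the squared distance \<open>r\<close> to the axis and the height \<open>h\<close>. Every
  quantity of the statement is an expression in them. The area element is \<open>D ds d\<phi>\<close> with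
  \<open>D\<^sup>2 = r h'\<^sup>2 + (1 + r/4) r'\<^sup>2/4\<close>, the third component of the normal is
  \<open>\<plusminus> r'/(2D)\<close>, and with \<open>\<kappa> = h'/D\<close> the mean curvature, for one of the two orientations, obeys
  \<open>r' H = (r \<kappa>)'\<close> (\<open>curvature_relation\<close>), the first variation of area with respect to \<open>h\<close>.

  The heart of the argument is that the energy density is a square plus a derivative:
  with \<open>T = - (1 + r/4) r'/(2D)\<close>,
  \<open>(H\<^sup>2 - n\<^sub>3\<^sup>2/4) D = (H - \<kappa>)\<^sup>2 D + T'\<close> (\<open>DERIV_T\<close>). Since the sphere is smooth at the
  poles, it meets the axis orthogonally, and \<open>T\<close> runs from \<open>- 1\<close> to \<open>1\<close> (\<open>T_limit\<close>).
  Therefore \<open>E = \<pi> + \<pi>/2 \<integral> (H - \<kappa>)\<^sup>2 D ds \<ge> \<pi>\<close>. Equality means \<open>H = \<kappa>\<close>; then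
  \<open>r \<kappa>' = r' (H - \<kappa>) = 0\<close>, so that \<open>\<kappa> = H\<close> is constant. Conversely, if \<open>H = c\<close>, then
  \<open>r (\<kappa> - c)\<close> has derivative zero and vanishes on the axis, hence \<open>\<kappa> = c = H\<close> and the
  square disappears (\<open>profile_energy\<close>).

  The rest of the work links these formulas to the definitions. Expressed in the left-invariant
  frame, the differential of the surface and its normal do not see left translations, and
  the covariant derivative is the ordinary one plus a constant bilinear map
  (\<open>has_vector_derivative_coframe_field\<close>). The
  principal curvatures enter only through the trace formula \<open>mean_curvature_eq\<close>, valid in
  any tangent frame in which the second fundamental form is symmetric. Away from the poles the
  coordinate frame is used. The poles, where it degenerates, are reached by continuity:
  symmetry of the second fundamental form extends to them, so the mean curvature is continuous
  on the whole sphere (\<open>continuous_on_mean_curvature\<close>). This makes the energy integrand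
  integrable, and lets constancy of \<open>H\<close> pass to the poles.\<close>

section \<open>Derivatives of smooth maps on the sphere\<close>

lemma smooth_map_local_derivative:
  assumes "smooth_map S F" "p \<in> S"
  obtains U g where "open U" "p \<in> U" "\<And>x. x \<in> U \<inter> S \<Longrightarrow> g x = F x"
    "\<And>x. x \<in> U \<Longrightarrow> (g has_derivative frechet_derivative g (at x)) (at x)"
    "\<And>v. continuous_on U (\<lambda>x. frechet_derivative g (at x) v)"
    "\<And>v x. x \<in> U \<Longrightarrow> (\<lambda>x. frechet_derivative g (at x) v) differentiable (at x)"
proof -
  obtain U g where *: "open U" "p \<in> U" "\<And>n. higher_differentiable_on U g n"
    "\<forall>x\<in>U \<inter> S. g x = F x"
    using assms unfolding smooth_map_def by blast
  have 1: "higher_differentiable_on U g (Suc 0)" and 2: "higher_differentiable_on U g (Suc (Suc 0))"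
    using *(3) by blast+
  show thesis
  proof (rule that[OF *(1,2)])
    show "g x = F x" if "x \<in> U \<inter> S" for x using *(4) that by blast
    show "(g has_derivative frechet_derivative g (at x)) (at x)" if "x \<in> U" for x
      using 1 that by (simp add: frechet_derivative_works)
    show "continuous_on U (\<lambda>x. frechet_derivative g (at x) v)" for v
      using 1 by simp
    show "(\<lambda>x. frechet_derivative g (at x) v) differentiable (at x)" if "x \<in> U" for v x
      using 2 that by simp
  qed
qed

lemma has_vector_derivative_sgn_line:
  assumes "p \<in> S2" "v \<in> tangent_S2 p"
  shows "((\<lambda>t. sgn (p + t *\<^sub>R v)) has_vector_derivative v) (at 0)"
proof -
  have pp: "p \<bullet> p = 1" and vp: "v \<bullet> p = 0" "p \<bullet> v = 0"
    using assms by (auto simp: tangent_S2_def dot_square_norm inner_commute)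
  have eq: "sgn (p + t *\<^sub>R v) = inverse (sqrt (1 + t\<^sup>2 * (v \<bullet> v))) *\<^sub>R (p + t *\<^sub>R v)" for t
    by (simp add: sgn_div_norm norm_eq_sqrt_inner inner_add_left inner_add_right pp vp
        power2_eq_square)
  have "((\<lambda>t. inverse (sqrt (1 + t\<^sup>2 * (v \<bullet> v)))) has_real_derivative 0) (at 0)"
    by (rule derivative_eq_intros refl | simp)+
  then have "((\<lambda>t. inverse (sqrt (1 + t\<^sup>2 * (v \<bullet> v))) *\<^sub>R (p + t *\<^sub>R v))
      has_vector_derivative (inverse (sqrt (1 + 0\<^sup>2 * (v \<bullet> v))) *\<^sub>R v + 0 *\<^sub>R (p + 0 *\<^sub>R v))) (at 0)"
    by (intro has_vector_derivative_scaleR) (auto intro!: derivative_eq_intros)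
  then show ?thesis by (simp add: eq)
qed

lemma sgn_line_in_S2:
  assumes "p \<in> S2" "v \<in> tangent_S2 p"
  shows "sgn (p + t *\<^sub>R v) \<in> S2"
proof -
  have "(p + t *\<^sub>R v) \<bullet> p = 1"
    using assms by (simp add: tangent_S2_def dot_square_norm inner_add_left)
  then have "p + t *\<^sub>R v \<noteq> 0" by auto
  then show ?thesis by (simp add: norm_sgn)
qed

lemma velocity_in_tangent_S2:
  assumes "\<And>t. \<alpha> t \<in> S2" "(\<alpha> has_vector_derivative v) (at t0)"
  shows "v \<in> tangent_S2 (\<alpha> t0)"
proof -
  have "((\<lambda>t. \<alpha> t \<bullet> \<alpha> t) has_vector_derivative (\<alpha> t0 \<bullet> v + v \<bullet> \<alpha> t0)) (at t0)"
    by (rule bounded_bilinear.has_vector_derivative[OF bounded_bilinear_inner assms(2,2)])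
  moreover have "(\<lambda>t. \<alpha> t \<bullet> \<alpha> t) = (\<lambda>t. 1)"
    using assms(1) by (auto simp: dot_square_norm)
  ultimately have "\<alpha> t0 \<bullet> v + v \<bullet> \<alpha> t0 = 0"
    using vector_derivative_unique_at[OF _ has_vector_derivative_const] by force
  then show ?thesis by (simp add: tangent_S2_def inner_commute)
qed

text \<open>The curve may leave the domain \<open>U\<close> of the extension, but not near \<open>t0\<close>; this is all that a
  derivative at \<open>t0\<close> sees.\<close>

lemma has_vector_derivative_extension:
  fixes \<alpha> :: "real \<Rightarrow> real^3"
  assumes "open U" "\<alpha> t0 \<in> U" "\<And>x. x \<in> U \<inter> S2 \<Longrightarrow> g x = F x"
    "(g has_derivative g') (at (\<alpha> t0))" "\<And>t. \<alpha> t \<in> S2" "(\<alpha> has_vector_derivative v) (at t0)"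
  shows "((\<lambda>t. F (\<alpha> t)) has_vector_derivative g' v) (at t0)"
proof -
  have "((\<lambda>t. g (\<alpha> t)) has_vector_derivative g' v) (at t0)"
    using has_derivative_compose[OF assms(6)[unfolded has_vector_derivative_def] assms(4)]
    by (simp add: has_vector_derivative_def
        linear_simps(5)[OF has_derivative_bounded_linear[OF assms(4)]])
  moreover have "\<forall>\<^sub>F t in at t0. \<alpha> t \<in> U"
    using has_vector_derivative_continuous[OF assms(6)] assms(1,2)
    by (simp add: continuous_at topological_tendstoD)
  then have "\<forall>\<^sub>F t in nhds t0. \<alpha> t \<in> U"
    using assms(2) by (simp add: eventually_nhds_conv_at)
  then have "\<forall>\<^sub>F t in nhds t0. g (\<alpha> t) = F (\<alpha> t)"
    by eventually_elim (use assms in auto)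
  ultimately show ?thesis
    unfolding has_vector_derivative_def
    by (rule has_derivative_transform_eventually[OF _ eventually_nhds_conv_at[THEN iffD1, THEN conjunct1]])
       (use assms in auto)
qed

lemma sphere_deriv_extension:
  assumes "open U" "p \<in> U" "\<And>x. x \<in> U \<inter> S2 \<Longrightarrow> g x = F x"
    "(g has_derivative g') (at p)" "p \<in> S2" "v \<in> tangent_S2 p"
  shows "sphere_deriv F p v = g' v"
proof -
  have p: "sgn (p + 0 *\<^sub>R v) = p" using assms by (simp add: sgn_div_norm)
  have "((\<lambda>t. F (sgn (p + t *\<^sub>R v))) has_vector_derivative g' v) (at 0)"
    by (rule has_vector_derivative_extension[where \<alpha> = "\<lambda>t. sgn (p + t *\<^sub>R v)", OF assms(1) _ assms(3)])
       (simp_all only: p assms sgn_line_in_S2 has_vector_derivative_sgn_line)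
  then show ?thesis
    unfolding sphere_deriv_def by (rule vector_derivative_at)
qed

text \<open>The derivative along the particular curve \<open>sgn (p + t v)\<close> in the definition of
  \<open>sphere_deriv\<close> is the derivative along every curve in the sphere with the same velocity,
  since both are values of the differential of a local extension.\<close>

lemma sphere_deriv_chain:
  assumes "smooth_map S2 F" "\<And>t. \<alpha> t \<in> S2" "(\<alpha> has_vector_derivative v) (at t0)"
  shows "((\<lambda>t. F (\<alpha> t)) has_vector_derivative sphere_deriv F (\<alpha> t0) v) (at t0)"
proof -
  obtain U g where *: "open U" "\<alpha> t0 \<in> U" "\<And>x. x \<in> U \<inter> S2 \<Longrightarrow> g x = F x"
    "\<And>x. x \<in> U \<Longrightarrow> (g has_derivative frechet_derivative g (at x)) (at x)"
    by (rule smooth_map_local_derivative[OF assms(1) assms(2)[of t0]]) (rule that; assumption)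
  show ?thesis
    using has_vector_derivative_extension[OF *(1-3) *(4)[OF *(2)] assms(2,3)]
      sphere_deriv_extension[OF *(1-3) *(4)[OF *(2)] assms(2)[of t0] velocity_in_tangent_S2[OF assms(2,3)]]
    by simp
qed

lemma sphere_deriv_linear:
  assumes "smooth_map S2 F" "p \<in> S2" "v \<in> tangent_S2 p" "w \<in> tangent_S2 p"
  shows "sphere_deriv F p (a *\<^sub>R v + b *\<^sub>R w) = a *\<^sub>R sphere_deriv F p v + b *\<^sub>R sphere_deriv F p w"
proof -
  obtain U g where *: "open U" "p \<in> U" "\<And>x. x \<in> U \<inter> S2 \<Longrightarrow> g x = F x"
    "\<And>x. x \<in> U \<Longrightarrow> (g has_derivative frechet_derivative g (at x)) (at x)"
    by (rule smooth_map_local_derivative[OF assms(1,2)]) (rule that; assumption)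
  note ext = sphere_deriv_extension[OF *(1-3) *(4)[OF *(2)] assms(2)]
  have "a *\<^sub>R v + b *\<^sub>R w \<in> tangent_S2 p"
    using assms by (simp add: tangent_S2_def inner_add_left)
  with ext assms show ?thesis
    using has_derivative_linear[OF *(4)[OF *(2)]]
    by (simp add: linear_add linear_scale)
qed

text \<open>The sphere has no continuous global tangent frame. Projecting a fixed vector \<open>b\<close> to the
  tangent planes gives a continuous tangent field that equals \<open>b\<close> wherever \<open>b\<close> is tangent;
  continuity on the sphere is expressed with such fields.\<close>

definition tangent_part :: "real^3 \<Rightarrow> real^3 \<Rightarrow> real^3" where
  "tangent_part b p = b - (b \<bullet> p) *\<^sub>R p"

lemma tangent_part_in_tangent_S2: "p \<in> S2 \<Longrightarrow> tangent_part b p \<in> tangent_S2 p"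
  by (simp add: tangent_part_def tangent_S2_def inner_diff_left dot_square_norm)

lemma tangent_part_tangent: "b \<in> tangent_S2 p \<Longrightarrow> tangent_part b p = b"
  by (simp add: tangent_part_def tangent_S2_def)

lemma linear_axis_sum:
  fixes L :: "real^'n \<Rightarrow> 'b::real_vector"
  assumes "linear L"
  shows "L v = (\<Sum>i\<in>UNIV. v $ i *\<^sub>R L (axis i 1))"
proof -
  have "L v = L (\<Sum>i\<in>UNIV. v $ i *\<^sub>R axis i 1)"
    using basis_expansion[of v] by (simp add: scalar_mult_eq_scaleR)
  then show ?thesis by (simp add: linear_sum[OF assms] linear_scale[OF assms])
qed

lemma continuous_on_sphere_deriv:
  assumes "smooth_map S2 F"
  shows "continuous_on S2 (\<lambda>p. sphere_deriv F p (tangent_part b p))"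
  unfolding continuous_on_eq_continuous_within
proof
  fix p assume p: "p \<in> S2"
  obtain U g where *: "open U" "p \<in> U" "\<And>x. x \<in> U \<inter> S2 \<Longrightarrow> g x = F x"
    "\<And>x. x \<in> U \<Longrightarrow> (g has_derivative frechet_derivative g (at x)) (at x)"
    and c: "\<And>v. continuous_on U (\<lambda>x. frechet_derivative g (at x) v)"
    by (rule smooth_map_local_derivative[OF assms p]) (rule that; assumption)
  have "continuous_on U (\<lambda>x. \<Sum>i\<in>UNIV. tangent_part b x $ i *\<^sub>R frechet_derivative g (at x) (axis i 1))"
    unfolding tangent_part_def by (intro continuous_intros c)
  moreover have "(\<Sum>i\<in>UNIV. tangent_part b x $ i *\<^sub>R frechet_derivative g (at x) (axis i 1))
      = frechet_derivative g (at x) (tangent_part b x)" if "x \<in> U" for x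
    using linear_axis_sum[OF has_derivative_linear[OF *(4)[OF that]]] by metis
  ultimately have "continuous_on U (\<lambda>x. frechet_derivative g (at x) (tangent_part b x))"
    by (metis (no_types, lifting) continuous_on_cong)
  then have "continuous_on (U \<inter> S2) (\<lambda>x. sphere_deriv F x (tangent_part b x))"
    by (rule continuous_on_eq[OF continuous_on_subset])
       (use sphere_deriv_extension[OF *(1) _ *(3) *(4)] tangent_part_in_tangent_S2 in auto)
  then have "continuous (at p within U \<inter> S2) (\<lambda>x. sphere_deriv F x (tangent_part b x))"
    using p *(2) by (simp add: continuous_on_eq_continuous_within)
  then show "continuous (at p within S2) (\<lambda>x. sphere_deriv F x (tangent_part b x))"
    using at_within_nhd[of p U "U \<inter> S2" S2] *(1,2) by (simp add: continuous_within Int_ac)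
qed

lemma smooth_map_continuous_on: 
  assumes "smooth_map S2 F" shows "continuous_on S2 F"
  unfolding continuous_on_eq_continuous_within
proof
  fix p assume p: "p \<in> S2"
  obtain U g where *: "open U" "p \<in> U" "\<And>x. x \<in> U \<inter> S2 \<Longrightarrow> g x = F x"
    "\<And>x. x \<in> U \<Longrightarrow> (g has_derivative frechet_derivative g (at x)) (at x)"
    by (rule smooth_map_local_derivative[OF assms p]) (rule that; assumption)
  have "continuous (at p within S2) g"
    using *(4)[OF *(2)] has_derivative_continuous continuous_at_imp_continuous_at_within by blast
  moreover have "\<forall>\<^sub>F x in at p within S2. x \<in> U"
    using *(1,2) eventually_at_topological by blast
  then have "\<forall>\<^sub>F x in at p within S2. g x = F x"
    unfolding eventually_at_filter by eventually_elim (use *(3) in auto)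
  moreover have "g p = F p" using *(2,3) p by auto
  ultimately show "continuous (at p within S2) F"
    by (simp add: continuous_within filterlim_cong[OF refl refl])
qed

text \<open>Second derivatives along a curve come from those of a local extension. The velocity is
  expanded in the standard basis, so that only differentials in fixed directions have to be
  differentiated.\<close>

lemma sphere_deriv_differentiable:
  assumes "smooth_map S2 F" "\<And>t. \<alpha> t \<in> S2" "\<And>t. (\<alpha> has_vector_derivative \<beta> t) (at t)"
    "\<beta> differentiable (at t0)"
  shows "(\<lambda>t. sphere_deriv F (\<alpha> t) (\<beta> t)) differentiable (at t0)"
proof -
  obtain U g where *: "open U" "\<alpha> t0 \<in> U" "\<And>x. x \<in> U \<inter> S2 \<Longrightarrow> g x = F x"
    "\<And>x. x \<in> U \<Longrightarrow> (g has_derivative frechet_derivative g (at x)) (at x)"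
    and d: "\<And>v x. x \<in> U \<Longrightarrow> (\<lambda>x. frechet_derivative g (at x) v) differentiable (at x)"
    by (rule smooth_map_local_derivative[OF assms(1) assms(2)[of t0]]) (rule that; assumption)
  let ?G = "\<lambda>t. \<Sum>i\<in>UNIV. \<beta> t $ i *\<^sub>R frechet_derivative g (at (\<alpha> t)) (axis i 1)"
  have "\<alpha> differentiable (at t0)"
    using assms(3) by (auto simp: has_vector_derivative_def differentiable_def)
  then have "(\<lambda>t. frechet_derivative g (at (\<alpha> t)) (axis i 1)) differentiable (at t0)" for i
    using differentiable_chain_at[of \<alpha> t0, OF _ d[OF *(2), of "axis i 1"]] by (simp add: comp_def)
  moreover have "(\<lambda>t. \<beta> t $ i) differentiable (at t0)" for i
    using differentiable_chain_at[where g = "\<lambda>x. x $ i",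
        OF assms(4) bounded_linear_imp_differentiable[OF bounded_linear_vec_nth]]
    by (simp add: comp_def)
  ultimately have "?G differentiable (at t0)"
    by (intro differentiable_sum differentiable_scaleR) auto
  then obtain D where D: "(?G has_derivative D) (at t0)"
    by (auto simp: differentiable_def)
  have eq: "?G t = sphere_deriv F (\<alpha> t) (\<beta> t)" if "\<alpha> t \<in> U" for t
  proof -
    have "sphere_deriv F (\<alpha> t) (\<beta> t) = frechet_derivative g (at (\<alpha> t)) (\<beta> t)"
      by (rule sphere_deriv_extension[OF *(1) that *(3) *(4)[OF that] assms(2)
            velocity_in_tangent_S2[OF assms(2,3)]])
    also have "\<dots> = ?G t"
      by (rule linear_axis_sum[OF has_derivative_linear[OF *(4)[OF that]]])
    finally show ?thesis by (rule sym)
  qed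
  have "continuous (at t0) \<alpha>"
    using assms(3) has_vector_derivative_continuous by blast
  then have "\<forall>\<^sub>F t in at t0. \<alpha> t \<in> U"
    using *(1,2) by (simp add: continuous_at topological_tendstoD)
  then have "\<forall>\<^sub>F t in at t0. ?G t = sphere_deriv F (\<alpha> t) (\<beta> t)"
    by eventually_elim (rule eq)
  then have "((\<lambda>t. sphere_deriv F (\<alpha> t) (\<beta> t)) has_derivative D) (at t0)"
    by (rule has_derivative_transform_eventually[OF D]) (use eq[OF *(2)] in auto)
  then show ?thesis
    unfolding differentiable_def by blast
qed

section \<open>The trace of a symmetric form relative to a metric\<close>

lemma orthonormal_triple_eqI:
  fixes u v w x y :: "real^3"
  assumes "u \<bullet> u = 1" "v \<bullet> v = 1" "w \<bullet> w = 1" "u \<bullet> v = 0" "u \<bullet> w = 0" "v \<bullet> w = 0"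
    and "x \<bullet> u = y \<bullet> u" "x \<bullet> v = y \<bullet> v" "x \<bullet> w = y \<bullet> w"
  shows "x = y"
proof -
  let ?B = "{u, v, w}"
  have ne: "u \<noteq> v" "u \<noteq> w" "v \<noteq> w" "u \<noteq> 0" "v \<noteq> 0" "w \<noteq> 0" using assms by auto
  have "pairwise orthogonal ?B"
    using assms by (auto simp: pairwise_def orthogonal_def inner_commute)
  then have "independent ?B"
    using ne by (intro pairwise_orthogonal_independent) auto
  moreover have "card ?B = 3" using ne by simp
  ultimately have "UNIV \<subseteq> span ?B"
    by (intro card_ge_dim_independent) (auto simp: dim_UNIV)
  moreover have "orthogonal (x - y) b" if "b \<in> ?B" for b
    using that assms by (auto simp: orthogonal_def inner_diff_left)
  ultimately have "orthogonal (x - y) (x - y)"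
    using orthogonal_to_span[of "x - y" ?B "x - y"] by blast
  then show ?thesis by (simp add: orthogonal_def)
qed

text \<open>The expression is the off-diagonal entry of the symmetric matrix with entries \<open>l, m, n\<close>
  after rotation by the angle with cosine \<open>c\<close> and sine \<open>s\<close>. It depends on the double angle
  only, so half the polar angle of \<open>((l - n)/2, m)\<close> makes it vanish.\<close>

lemma exists_diagonalizing_angle:
  fixes l m n :: real
  obtains c s where "c\<^sup>2 + s\<^sup>2 = 1" "m * (c\<^sup>2 - s\<^sup>2) + (n - l) * c * s = 0"
proof -
  obtain R t where "Complex ((l - n) / 2) m = rcis R t" using rcis_Ex by blast
  then have t: "(l - n) / 2 = R * cos t" "m = R * sin t"
    by (metis Re_rcis complex.sel(1), metis Im_rcis complex.sel(2))
  have "m * ((cos (t/2))\<^sup>2 - (sin (t/2))\<^sup>2) + (n - l) * cos (t/2) * sin (t/2)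
     = m * cos t - (l - n) / 2 * sin t"
  proof -
    have "cos t = (cos (t/2))\<^sup>2 - (sin (t/2))\<^sup>2" "sin t = 2 * sin (t/2) * cos (t/2)"
      using cos_double[of "t/2"] sin_double[of "t/2"] by simp_all
    then show ?thesis by (simp only:) (simp add: field_simps)
  qed
  then show thesis using that[of "cos (t/2)" "sin (t/2)"] t by (simp add: mult.commute)
qed

text \<open>If \<open>P\<close> is the matrix with rows \<open>(a, b)\<close> and \<open>(c, d)\<close> and \<open>g\<close> the Gram matrix with
  entries \<open>E, F, G\<close>, the hypotheses say \<open>P g P\<^sup>T = 1\<close>, and the conclusion is
  \<open>P\<^sup>T P = g\<^sup>-\<^sup>1\<close>. It turns the sum of the eigenvalues into a trace with respect to \<open>g\<close>.\<close>

lemma orthonormal_combinations_trace: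
  fixes E F G :: real
  assumes "E * a\<^sup>2 + 2 * F * a * b + G * b\<^sup>2 = 1" "E * c\<^sup>2 + 2 * F * c * d + G * d\<^sup>2 = 1"
    "E * a * c + F * (a * d + b * c) + G * b * d = 0"
  shows "(E * G - F\<^sup>2) * (a\<^sup>2 + c\<^sup>2) = G" "(E * G - F\<^sup>2) * (b\<^sup>2 + d\<^sup>2) = E"
    "(E * G - F\<^sup>2) * (a * b + c * d) = - F"
proof -
  have det: "(E * G - F\<^sup>2) * (a * d - b * c)\<^sup>2 = 1"
    using assms by algebra
  have "(E * a + F * b) * a + (F * a + G * b) * b = 1" "(E * a + F * b) * c + (F * a + G * b) * d = 0"
    "(E * c + F * d) * a + (F * c + G * d) * b = 0" "(E * c + F * d) * c + (F * c + G * d) * d = 1"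
    using assms by algebra+
  then have *: "(a * d - b * c) * (E * a + F * b) = d" "(a * d - b * c) * (F * a + G * b) = - c"
    "(a * d - b * c) * (E * c + F * d) = - b" "(a * d - b * c) * (F * c + G * d) = a"
    by algebra+
  let ?J = "a * d - b * c"
  have "a\<^sup>2 + c\<^sup>2 = a * (?J * (F * c + G * d)) - c * (?J * (F * a + G * b))"
    unfolding * by (simp add: power2_eq_square)
  also have "\<dots> = ?J\<^sup>2 * G" by algebra
  finally show "(E * G - F\<^sup>2) * (a\<^sup>2 + c\<^sup>2) = G" using det by algebra
  have "b\<^sup>2 + d\<^sup>2 = d * (?J * (E * a + F * b)) - b * (?J * (E * c + F * d))"
    unfolding * by (simp add: power2_eq_square)
  also have "\<dots> = ?J\<^sup>2 * E" by algebra
  finally show "(E * G - F\<^sup>2) * (b\<^sup>2 + d\<^sup>2) = E" using det by algebra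
  have "a * b + c * d = c * (?J * (E * a + F * b)) - a * (?J * (E * c + F * d))"
    unfolding * by simp
  also have "\<dots> = - (?J\<^sup>2 * F)" by algebra
  finally show "(E * G - F\<^sup>2) * (a * b + c * d) = - F" using det by algebra
qed

text \<open>The spectral theorem for the shape operator: \<open>a1, a2\<close> span the tangent plane, the operator
  sends them to \<open>c1, c2\<close>, and \<open>\<nu>\<close> is the normal. The basis is first made orthonormal
  (Gram-Schmidt) and then rotated until the second fundamental form is diagonal.\<close>

lemma orthonormal_eigenbasis_exists:
  fixes a1 a2 c1 c2 \<nu> :: "real^3"
  assumes gram: "(a1 \<bullet> a1) * (a2 \<bullet> a2) - (a1 \<bullet> a2)\<^sup>2 > 0"
    and sym: "c1 \<bullet> a2 = c2 \<bullet> a1"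
    and nu: "\<nu> \<bullet> \<nu> = 1" "a1 \<bullet> \<nu> = 0" "a2 \<bullet> \<nu> = 0" "c1 \<bullet> \<nu> = 0" "c2 \<bullet> \<nu> = 0"
  obtains a b c d k1 k2 where
    "(a *\<^sub>R a1 + b *\<^sub>R a2) \<bullet> (a *\<^sub>R a1 + b *\<^sub>R a2) = 1"
    "(c *\<^sub>R a1 + d *\<^sub>R a2) \<bullet> (c *\<^sub>R a1 + d *\<^sub>R a2) = 1"
    "(a *\<^sub>R a1 + b *\<^sub>R a2) \<bullet> (c *\<^sub>R a1 + d *\<^sub>R a2) = 0"
    "a *\<^sub>R c1 + b *\<^sub>R c2 = k1 *\<^sub>R (a *\<^sub>R a1 + b *\<^sub>R a2)"
    "c *\<^sub>R c1 + d *\<^sub>R c2 = k2 *\<^sub>R (c *\<^sub>R a1 + d *\<^sub>R a2)"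
proof -
  define E F G where "E = a1 \<bullet> a1" "F = a1 \<bullet> a2" "G = a2 \<bullet> a2"
  define W where "W = E * G - F\<^sup>2"
  have W: "W > 0" using gram by (simp add: W_def E_F_G_def)
  then have "E \<noteq> 0" unfolding W_def by (metis diff_gt_0_iff_gt mult_zero_left not_less zero_le_power2)
  then have E: "E > 0" by (simp add: E_F_G_def order_le_neq_trans)
  \<comment> \<open>Gram-Schmidt: \<open>p a1\<close> and \<open>q a1 + r a2\<close> are orthonormal, where \<open>W\<close> is the Gram
    determinant.\<close>
  define p q r where "p = 1 / sqrt E" "q = - F / (sqrt E * sqrt W)" "r = E / (sqrt E * sqrt W)"
  have p2: "E * p\<^sup>2 = 1" using E by (simp add: p_q_r_def power_divide)
  have pq: "E * p * q + F * p * r = 0" by (simp add: p_q_r_def)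
  have qr: "E * q\<^sup>2 + 2 * F * q * r + G * r\<^sup>2 = 1"
  proof -
    have "E * q\<^sup>2 + 2 * F * q * r + G * r\<^sup>2 = (E * F\<^sup>2 - 2 * F\<^sup>2 * E + G * E\<^sup>2) / (sqrt E * sqrt W)\<^sup>2"
      by (simp add: p_q_r_def power_divide add_divide_distrib diff_divide_distrib power2_eq_square)
    also have "E * F\<^sup>2 - 2 * F\<^sup>2 * E + G * E\<^sup>2 = E * W"
      by (simp add: W_def algebra_simps power2_eq_square)
    finally show ?thesis using E W by (simp add: power_mult_distrib)
  qed
  define u1 u2 where "u1 = p *\<^sub>R a1" "u2 = q *\<^sub>R a1 + r *\<^sub>R a2"
  define d1 d2 where "d1 = p *\<^sub>R c1" "d2 = q *\<^sub>R c1 + r *\<^sub>R c2"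
  note uds = u1_u2_def d1_d2_def
  have on: "u1 \<bullet> u1 = 1" "u2 \<bullet> u2 = 1" "u1 \<bullet> u2 = 0" "u2 \<bullet> u1 = 0"
    using p2 pq qr unfolding uds
    by (simp_all add: inner_add_left inner_add_right E_F_G_def[symmetric] inner_commute[of a2 a1]
        power2_eq_square algebra_simps)
  have dsym: "d1 \<bullet> u2 = d2 \<bullet> u1"
    using sym by (simp add: uds inner_add_left inner_add_right algebra_simps)
  have nu': "u1 \<bullet> \<nu> = 0" "u2 \<bullet> \<nu> = 0" "d1 \<bullet> \<nu> = 0" "d2 \<bullet> \<nu> = 0"
    using nu by (simp_all add: uds inner_add_left)
  obtain x y where xy: "x\<^sup>2 + y\<^sup>2 = 1"
    "(d1 \<bullet> u2) * (x\<^sup>2 - y\<^sup>2) + (d2 \<bullet> u2 - d1 \<bullet> u1) * x * y = 0"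
    using exists_diagonalizing_angle by blast
  define v1 v2 where "v1 = x *\<^sub>R u1 + y *\<^sub>R u2" "v2 = (- y) *\<^sub>R u1 + x *\<^sub>R u2"
  define e1 e2 where "e1 = x *\<^sub>R d1 + y *\<^sub>R d2" "e2 = (- y) *\<^sub>R d1 + x *\<^sub>R d2"
  note ves = v1_v2_def e1_e2_def
  have von: "v1 \<bullet> v1 = 1" "v2 \<bullet> v2 = 1" "v1 \<bullet> v2 = 0"
    using xy(1) by (simp_all add: ves inner_add_left inner_add_right on inner_diff_left inner_diff_right
        power2_eq_square algebra_simps)
  have e12: "e1 \<bullet> v2 = 0" "e2 \<bullet> v1 = 0"
    using xy(2) by (simp_all add: ves inner_add_left inner_add_right on inner_diff_left inner_diff_right
        power2_eq_square dsym algebra_simps)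
  have nu'': "v1 \<bullet> \<nu> = 0" "v2 \<bullet> \<nu> = 0" "e1 \<bullet> \<nu> = 0" "e2 \<bullet> \<nu> = 0"
    using nu' by (simp_all add: ves inner_add_left inner_diff_left)
  have k1: "e1 = (e1 \<bullet> v1) *\<^sub>R v1"
    by (rule orthonormal_triple_eqI[OF von(1,2) nu(1) von(3) nu''(1,2)]) (simp_all add: von e12 nu'')
  have k2: "e2 = (e2 \<bullet> v2) *\<^sub>R v2"
    by (rule orthonormal_triple_eqI[OF von(1,2) nu(1) von(3) nu''(1,2)])
       (simp_all add: von e12 nu'' inner_commute[of v2 v1])
  have comb: "v1 = (x * p + y * q) *\<^sub>R a1 + (y * r) *\<^sub>R a2" "v2 = (x * q - y * p) *\<^sub>R a1 + (x * r) *\<^sub>R a2"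
    "e1 = (x * p + y * q) *\<^sub>R c1 + (y * r) *\<^sub>R c2" "e2 = (x * q - y * p) *\<^sub>R c1 + (x * r) *\<^sub>R c2"
    by (simp_all add: ves uds algebra_simps)
  show thesis
    by (rule that[of "x * p + y * q" "y * r" "x * q - y * p" "x * r" "e1 \<bullet> v1" "e2 \<bullet> v2"];
        unfold comb[symmetric]) (rule von k1 k2)+
qed

lemma dim_tangent_S2:
  assumes "p \<in> S2"
  shows "dim (tangent_S2 p) = 2"
proof -
  have "p \<noteq> 0" using assms by auto
  then show ?thesis
    using dim_hyperplane[of p] by (simp add: tangent_S2_def inner_commute)
qed

lemma tangent_S2_combination:
  assumes "p \<in> S2" "b1 \<in> tangent_S2 p" "b2 \<in> tangent_S2 p" "v \<in> tangent_S2 p"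
    and indep: "\<And>x y. x *\<^sub>R b1 + y *\<^sub>R b2 = 0 \<Longrightarrow> x = 0 \<and> y = 0"
  obtains x y where "v = x *\<^sub>R b1 + y *\<^sub>R b2"
proof -
  have ne: "b1 \<noteq> b2" using indep[of 1 "-1"] by auto
  have "independent {b1, b2}"
  proof (rule independent_insertI)
    show "b1 \<notin> span {b2}"
    proof
      assume "b1 \<in> span {b2}"
      then obtain k where "b1 = k *\<^sub>R b2" by (auto simp: span_singleton)
      then show False using indep[of 1 "- k"] by simp
    qed
    have "b2 \<noteq> 0" using indep[of 0 1] by auto
    then show "independent {b2}" by simp
  qed
  then have "tangent_S2 p \<subseteq> span {b1, b2}"
    using assms(2,3) ne dim_tangent_S2[OF assms(1)] by (intro card_ge_dim_independent) auto
  then obtain k l where "v - k *\<^sub>R b1 = l *\<^sub>R b2"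
    using assms(4) by (auto simp: span_insert span_singleton dest!: subsetD)
  then have "v = k *\<^sub>R b1 + l *\<^sub>R b2" by (simp add: algebra_simps)
  then show thesis by (rule that)
qed

section \<open>The left-invariant frame of Nil and its connection\<close>

text \<open>The components of \<open>v\<close> in the frame \<open>e\<^sub>1, e\<^sub>2, e\<^sub>3\<close> at \<open>p\<close>.\<close>

definition nil_coframe :: "real^3 \<Rightarrow> real^3 \<Rightarrow> real^3" where
  "nil_coframe p v = vector [v$1, v$2, v$3 - p$1 * v$2]"

text \<open>The Levi-Civita connection on left-invariant fields, in frame components: \<open>\<nabla>\<^sub>a b\<close>. It
  follows from the Koszul formula and the only nonzero bracket \<open>[e\<^sub>1, e\<^sub>2] = e\<^sub>3\<close>.\<close>

definition nil_connection :: "real^3 \<Rightarrow> real^3 \<Rightarrow> real^3" where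
  "nil_connection a b = (1/2) *\<^sub>R vector
     [a$2 * b$3 + a$3 * b$2, - (a$1 * b$3 + a$3 * b$1), a$1 * b$2 - a$2 * b$1]"

lemma nil_coframe_nth [simp]:
  "nil_coframe p v $ 1 = v$1" "nil_coframe p v $ 2 = v$2" "nil_coframe p v $ 3 = v$3 - p$1 * v$2"
  by (simp_all add: nil_coframe_def)

lemma nil_connection_nth [simp]:
  "nil_connection a b $ 1 = (a$2 * b$3 + a$3 * b$2) / 2"
  "nil_connection a b $ 2 = - (a$1 * b$3 + a$3 * b$1) / 2"
  "nil_connection a b $ 3 = (a$1 * b$2 - a$2 * b$1) / 2"
  by (simp_all add: nil_connection_def)

lemma inner_vec3: "x \<bullet> y = x$1 * y$1 + x$2 * y$2 + x$3 * y$3" for x y :: "real^3"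
  by (simp add: inner_vec_def sum_3)

lemma nil_inner_coframe: "nil_inner p v w = nil_coframe p v \<bullet> nil_coframe p w"
  by (simp add: nil_inner_def inner_vec3)

lemma linear_nil_coframe: "linear (nil_coframe p)"
  by (rule linearI) (simp_all add: vec_eq_iff forall_3 algebra_simps)

lemma nil_coframe_inject: "nil_coframe p v = nil_coframe p w \<longleftrightarrow> v = w"
  by (auto simp: vec_eq_iff forall_3)

text \<open>Compatibility of the connection with the metric.\<close>

lemma nil_connection_skew: "nil_connection a b \<bullet> c = - (b \<bullet> nil_connection a c)"
  by (simp add: inner_vec3 field_simps)

lemma nil_frame_3: "nil_coframe p (nil_frame 3 p) = axis 3 1"
proof -
  have eq: "nil_mult p b = p + (\<chi> i. b $ i + (if i = 3 then p$1 * b$2 else 0))" for b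
    by (simp add: vec_eq_iff forall_3 nil_mult_def)
  have lin: "linear (\<lambda>b. (\<chi> i. b $ i + (if i = 3 then p$1 * b$2 else 0)) :: real^3)"
    by (rule linearI) (simp_all add: vec_eq_iff forall_3 algebra_simps)
  have "(nil_mult p has_derivative (\<lambda>b. \<chi> i. b $ i + (if i = 3 then p$1 * b$2 else 0))) (at 0)"
    unfolding eq[abs_def]
    using has_derivative_add[OF has_derivative_const linear_imp_has_derivative[OF lin]] by simp
  from frechet_derivative_at[OF this, symmetric] show ?thesis
    by (simp add: nil_frame_def vec_eq_iff forall_3 axis_def)
qed

lemma nil_metric_matrix:
  "metric_matrix nil_inner p = vector [vector [1, 0, 0], vector [0, 1 + (p$1)\<^sup>2, - p$1], vector [0, - p$1, 1]]"
  by (simp add: vec_eq_iff forall_3 metric_matrix_def nil_inner_def axis_def power2_eq_square)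

lemma nil_metric_matrix_inv:
  "matrix_inv (metric_matrix nil_inner p) =
     vector [vector [1, 0, 0], vector [0, 1, p$1], vector [0, p$1, 1 + (p$1)\<^sup>2]]" (is "_ = ?B")
proof -
  have 1: "metric_matrix nil_inner p ** ?B = mat 1" "?B ** metric_matrix nil_inner p = mat 1"
    unfolding nil_metric_matrix
    by (simp_all add: vec_eq_iff forall_3 matrix_matrix_mult_def sum_3 mat_def algebra_simps power2_eq_square)
  have "C = ?B" if "metric_matrix nil_inner p ** C = mat 1" for C
  proof -
    have "C = (?B ** metric_matrix nil_inner p) ** C" unfolding 1(2) by simp
    also have "\<dots> = ?B ** (metric_matrix nil_inner p ** C)" by (rule matrix_mul_assoc[symmetric])
    finally show ?thesis unfolding that by simp
  qed
  with 1 show ?thesis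
    unfolding matrix_inv_def by (blast intro: some_equality)
qed

lemma nil_metric_partial:
  "metric_partial nil_inner p l i j =
     (if l = 1 then (vector [vector [0, 0, 0], vector [0, 2 * p$1, - 1], vector [0, - 1, 0]] :: real^3^3) $ i $ j else 0)"
proof -
  have D: "metric_partial nil_inner p l i j = f' (axis l 1)"
    if "((\<lambda>q. metric_matrix nil_inner q $ i $ j) has_derivative f') (at p)" for f'
    unfolding metric_partial_def using frechet_derivative_at[OF that] by simp
  have nth: "((\<lambda>q. q $ k) has_derivative (\<lambda>h. h $ k)) (at p)" for k :: 3
    by (rule bounded_linear.has_derivative[OF bounded_linear_vec_nth has_derivative_ident])
  have 0: "metric_partial nil_inner p l i j = 0" if "\<And>q. metric_matrix nil_inner q $ i $ j = c" for c
    using D[unfolded that, OF has_derivative_const] by simp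
  have x: "metric_partial nil_inner p l i j = - axis l 1 $ 1" if "\<And>q. metric_matrix nil_inner q $ i $ j = - q$1"
    using D[unfolded that, OF has_derivative_minus[OF nth]] by simp
  have xx: "metric_partial nil_inner p l i j = 2 * p$1 * axis l 1 $ 1"
    if "\<And>q. metric_matrix nil_inner q $ i $ j = 1 + (q$1)\<^sup>2"
    by (subst D[unfolded that, OF has_derivative_add[OF has_derivative_const has_derivative_power[OF nth]]])
       simp
  consider "i = 1 \<or> j = 1" | "i = 2" "j = 2" | "i = 2" "j = 3" | "i = 3" "j = 2" | "i = 3" "j = 3"
    using exhaust_3[of i] exhaust_3[of j] by blast
  then show ?thesis
  proof cases
    case 1
    then have "metric_matrix nil_inner q $ i $ j = (if i = 1 \<and> j = 1 then 1 else 0)" for q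
      using exhaust_3[of i] exhaust_3[of j] by (auto simp: nil_metric_matrix)
    from 0[OF this] show ?thesis
      using 1 exhaust_3[of i] exhaust_3[of j] by auto
  next
    case 2
    then have "metric_matrix nil_inner q $ i $ j = 1 + (q$1)\<^sup>2" for q
      by (simp add: nil_metric_matrix)
    from xx[OF this] show ?thesis using 2 by (simp add: axis_def)
  next
    case 3
    then have "metric_matrix nil_inner q $ i $ j = - q$1" for q
      by (simp add: nil_metric_matrix)
    from x[OF this] show ?thesis using 3 by (simp add: axis_def)
  next
    case 4
    then have "metric_matrix nil_inner q $ i $ j = - q$1" for q
      by (simp add: nil_metric_matrix)
    from x[OF this] show ?thesis using 4 by (simp add: axis_def)
  next
    case 5
    then have "metric_matrix nil_inner q $ i $ j = 1" for q
      by (simp add: nil_metric_matrix)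
    from 0[OF this] show ?thesis using 5 by simp
  qed
qed

text \<open>The last vector compensates for the dependence of the frame on the point: it is the
  derivative of the factor \<open>p$1\<close> in \<open>nil_coframe\<close>. In the derivative of the frame components of
  a vector field it cancels (see \<open>has_vector_derivative_coframe_field\<close>).\<close>

lemma nil_christoffel_coframe:
  "nil_coframe p (\<chi> k. \<Sum>i\<in>UNIV. \<Sum>j\<in>UNIV. christoffel nil_inner p k i j * v $ i * w $ j)
     = nil_connection (nil_coframe p v) (nil_coframe p w) - vector [0, 0, v$1 * w$2]"
  by (simp add: vec_eq_iff forall_3 christoffel_def sum_3 nil_metric_matrix_inv nil_metric_partial
      field_simps power2_eq_square)

lemma has_vector_derivative_vec_nth:
  fixes f :: "real \<Rightarrow> real^'n"
  assumes "(f has_vector_derivative f') (at t)"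
  shows "((\<lambda>t. f t $ i) has_real_derivative f' $ i) (at t)"
  using bounded_linear.has_vector_derivative[OF bounded_linear_vec_nth assms]
  by (simp add: has_real_derivative_iff_has_vector_derivative)

lemma has_vector_derivative_vecI:
  fixes f :: "real \<Rightarrow> real^'n"
  assumes "\<And>i. ((\<lambda>t. f t $ i) has_real_derivative f' $ i) (at t)"
  shows "(f has_vector_derivative f') (at t)"
proof -
  have *: "(\<Sum>i\<in>UNIV. x $ i *\<^sub>R axis i 1) = x" for x :: "real^'n"
    using basis_expansion[of x] by (simp add: scalar_mult_eq_scaleR)
  have "((\<lambda>t. \<Sum>i\<in>UNIV. f t $ i *\<^sub>R axis i 1 :: real^'n) has_vector_derivative (\<Sum>i\<in>UNIV. f' $ i *\<^sub>R axis i 1)) (at t)"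
    using assms
    by (intro has_vector_derivative_sum)
       (auto simp: has_real_derivative_iff_has_vector_derivative
         intro!: bounded_linear.has_vector_derivative[OF bounded_linear_scaleR_left])
  then show ?thesis unfolding * .
qed

lemma nil_coframe_covariant_deriv:
  "nil_coframe (f p) (covariant_deriv f n p v) =
     nil_coframe (f p) (sphere_deriv n p v)
     + nil_connection (nil_coframe (f p) (sphere_deriv f p v)) (nil_coframe (f p) (n p))
     - vector [0, 0, sphere_deriv f p v $ 1 * n p $ 2]"
proof -
  have "covariant_deriv f n p v = sphere_deriv n p v +
     (\<chi> k. \<Sum>i\<in>UNIV. \<Sum>j\<in>UNIV. christoffel nil_inner (f p) k i j * sphere_deriv f p v $ i * n p $ j)"
    by (simp add: covariant_deriv_def vec_eq_iff)
  then show ?thesis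
    by (simp only: linear_add[OF linear_nil_coframe] nil_christoffel_coframe) simp
qed

text \<open>Hence the covariant derivative is the ordinary derivative of the frame components plus
  \<open>nil_connection\<close>, and no other trace of the coordinates remains.\<close>

lemma has_vector_derivative_coframe_field:
  assumes "smooth_map S2 f" "smooth_map S2 n" "\<And>t. \<alpha> t \<in> S2" "(\<alpha> has_vector_derivative v) (at t0)"
  shows "((\<lambda>t. nil_coframe (f (\<alpha> t)) (n (\<alpha> t))) has_vector_derivative
     nil_coframe (f (\<alpha> t0)) (covariant_deriv f n (\<alpha> t0) v)
       - nil_connection (nil_coframe (f (\<alpha> t0)) (sphere_deriv f (\<alpha> t0) v))
           (nil_coframe (f (\<alpha> t0)) (n (\<alpha> t0)))) (at t0)"
proof -
  let ?p = "f (\<alpha> t0)" and ?n = "n (\<alpha> t0)"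
  let ?df = "sphere_deriv f (\<alpha> t0) v" and ?dn = "sphere_deriv n (\<alpha> t0) v"
  have df: "((\<lambda>t. f (\<alpha> t) $ i) has_real_derivative ?df $ i) (at t0)"
    and dn: "((\<lambda>t. n (\<alpha> t) $ i) has_real_derivative ?dn $ i) (at t0)" for i
    by (intro has_vector_derivative_vec_nth sphere_deriv_chain assms)+
  have eq: "nil_coframe ?p (covariant_deriv f n (\<alpha> t0) v)
       - nil_connection (nil_coframe ?p ?df) (nil_coframe ?p ?n)
     = nil_coframe ?p ?dn - vector [0, 0, ?df$1 * ?n$2]"
    by (simp add: nil_coframe_covariant_deriv)
  have "((\<lambda>t. nil_coframe (f (\<alpha> t)) (n (\<alpha> t)) $ i) has_real_derivative
     (nil_coframe ?p ?dn - vector [0, 0, ?df$1 * ?n$2]) $ i) (at t0)" for i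
  proof -
    have "((\<lambda>t. n (\<alpha> t) $ 3 - f (\<alpha> t) $ 1 * n (\<alpha> t) $ 2) has_real_derivative
       ?dn $ 3 - (?df $ 1 * ?n $ 2 + ?dn $ 2 * ?p $ 1)) (at t0)"
      by (intro DERIV_diff DERIV_mult df dn)
    then show ?thesis using exhaust_3[of i] dn by (auto simp: algebra_simps)
  qed
  then show ?thesis unfolding eq by (rule has_vector_derivative_vecI)
qed

section \<open>Mean curvature of immersed spheres\<close>

locale nil_surface =
  fixes f n :: "real^3 \<Rightarrow> real^3"
  assumes immersed: "immersed_sphere f" and normal: "unit_normal f n"
begin

lemma smooth: "smooth_map S2 f" and smooth_normal: "smooth_map S2 n"
  using immersed normal by (simp_all add: immersed_sphere_def unit_normal_def)

definition frame_deriv :: "real^3 \<Rightarrow> real^3 \<Rightarrow> real^3" where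
  "frame_deriv p v = nil_coframe (f p) (sphere_deriv f p v)"

definition gauss_map :: "real^3 \<Rightarrow> real^3" where
  "gauss_map p = nil_coframe (f p) (n p)"

definition shape :: "real^3 \<Rightarrow> real^3 \<Rightarrow> real^3" where
  "shape p v = - nil_coframe (f p) (covariant_deriv f n p v)"

definition second_form :: "real^3 \<Rightarrow> real^3 \<Rightarrow> real^3 \<Rightarrow> real" where
  "second_form p v w = shape p v \<bullet> frame_deriv p w"

definition gram :: "real^3 \<Rightarrow> real^3 \<Rightarrow> real^3 \<Rightarrow> real" where
  "gram p v w = (frame_deriv p v \<bullet> frame_deriv p v) * (frame_deriv p w \<bullet> frame_deriv p w)
     - (frame_deriv p v \<bullet> frame_deriv p w)\<^sup>2"

lemma nil_inner_frame_deriv: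
  "nil_inner (f p) (sphere_deriv f p v) (sphere_deriv f p w) = frame_deriv p v \<bullet> frame_deriv p w"
  by (simp add: nil_inner_coframe frame_deriv_def)

lemma gauss_map_unit: "p \<in> S2 \<Longrightarrow> gauss_map p \<bullet> gauss_map p = 1"
  using normal by (simp add: unit_normal_def gauss_map_def nil_inner_coframe)

lemma gauss_map_normal:
  "p \<in> S2 \<Longrightarrow> v \<in> tangent_S2 p \<Longrightarrow> gauss_map p \<bullet> frame_deriv p v = 0"
  using normal by (simp add: unit_normal_def gauss_map_def frame_deriv_def nil_inner_coframe)

lemma frame_deriv_linear:
  assumes "p \<in> S2" "v \<in> tangent_S2 p" "w \<in> tangent_S2 p"
  shows "frame_deriv p (a *\<^sub>R v + b *\<^sub>R w) = a *\<^sub>R frame_deriv p v + b *\<^sub>R frame_deriv p w"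
  by (simp add: frame_deriv_def sphere_deriv_linear[OF smooth assms] linear_add[OF linear_nil_coframe]
      linear_scale[OF linear_nil_coframe])

lemma shape_linear:
  assumes "p \<in> S2" "v \<in> tangent_S2 p" "w \<in> tangent_S2 p"
  shows "shape p (a *\<^sub>R v + b *\<^sub>R w) = a *\<^sub>R shape p v + b *\<^sub>R shape p w"
  by (simp add: shape_def nil_coframe_covariant_deriv sphere_deriv_linear[OF smooth assms]
      sphere_deriv_linear[OF smooth_normal assms] vec_eq_iff forall_3 field_simps)

lemma gauss_map_derivative:
  assumes "\<And>t. \<alpha> t \<in> S2" "(\<alpha> has_vector_derivative v) (at t0)"
  shows "((\<lambda>t. gauss_map (\<alpha> t)) has_vector_derivative
     - shape (\<alpha> t0) v - nil_connection (frame_deriv (\<alpha> t0) v) (gauss_map (\<alpha> t0))) (at t0)"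
  using has_vector_derivative_coframe_field[OF smooth smooth_normal assms]
  by (simp add: gauss_map_def shape_def frame_deriv_def)

text \<open>Differentiate \<open>|\<nu>|\<^sup>2 = 1\<close> along a curve; the connection term drops out by metric
  compatibility.\<close>

lemma shape_tangential:
  assumes "p \<in> S2" "v \<in> tangent_S2 p"
  shows "shape p v \<bullet> gauss_map p = 0"
proof -
  let ?\<alpha> = "\<lambda>t. sgn (p + t *\<^sub>R v)"
  let ?d = "- shape p v - nil_connection (frame_deriv p v) (gauss_map p)"
  have p: "sgn p = p" using assms by (simp add: sgn_div_norm)
  have d: "((\<lambda>t. gauss_map (?\<alpha> t)) has_vector_derivative ?d) (at 0)"
    using gauss_map_derivative[of ?\<alpha> v 0, OF sgn_line_in_S2[OF assms] has_vector_derivative_sgn_line[OF assms]]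
    by (simp add: p)
  have "((\<lambda>t. gauss_map (?\<alpha> t) \<bullet> gauss_map (?\<alpha> t)) has_vector_derivative
      (gauss_map (?\<alpha> 0) \<bullet> ?d + ?d \<bullet> gauss_map (?\<alpha> 0))) (at 0)"
    by (rule bounded_bilinear.has_vector_derivative[OF bounded_bilinear_inner d d])
  moreover have "(\<lambda>t. gauss_map (?\<alpha> t) \<bullet> gauss_map (?\<alpha> t)) = (\<lambda>t. 1)"
    using gauss_map_unit[OF sgn_line_in_S2[OF assms]] by simp
  ultimately have "gauss_map (?\<alpha> 0) \<bullet> ?d + ?d \<bullet> gauss_map (?\<alpha> 0) = 0"
    using vector_derivative_unique_at[OF _ has_vector_derivative_const] by force
  then show ?thesis
    using nil_connection_skew[of "frame_deriv p v" "gauss_map p" "gauss_map p"]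
    by (simp add: p inner_commute inner_diff_left inner_diff_right)
qed

text \<open>Differentiating \<open>\<langle>\<nu>, W\<rangle> = 0\<close> moves the derivative from the normal to a tangent field \<open>W\<close>
  along the curve. For surfaces of revolution the tangent fields are explicit, so that the second
  fundamental form is found without differentiating the normal.\<close>

lemma second_form_moving_frame:
  assumes "\<And>t. \<alpha> t \<in> S2" "(\<alpha> has_vector_derivative v) (at t0)" "\<And>t. w t \<in> tangent_S2 (\<alpha> t)"
    and W: "((\<lambda>t. frame_deriv (\<alpha> t) (w t)) has_vector_derivative W') (at t0)"
  shows "second_form (\<alpha> t0) v (w t0) =
    gauss_map (\<alpha> t0) \<bullet> (W' + nil_connection (frame_deriv (\<alpha> t0) v) (frame_deriv (\<alpha> t0) (w t0)))"
proof -
  let ?d = "- shape (\<alpha> t0) v - nil_connection (frame_deriv (\<alpha> t0) v) (gauss_map (\<alpha> t0))"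
  have "((\<lambda>t. gauss_map (\<alpha> t) \<bullet> frame_deriv (\<alpha> t) (w t)) has_vector_derivative
      (gauss_map (\<alpha> t0) \<bullet> W' + ?d \<bullet> frame_deriv (\<alpha> t0) (w t0))) (at t0)"
    by (rule bounded_bilinear.has_vector_derivative[OF bounded_bilinear_inner
          gauss_map_derivative[OF assms(1,2)] W])
  moreover have "(\<lambda>t. gauss_map (\<alpha> t) \<bullet> frame_deriv (\<alpha> t) (w t)) = (\<lambda>t. 0)"
    using gauss_map_normal assms(1,3) by simp
  ultimately have "gauss_map (\<alpha> t0) \<bullet> W' + ?d \<bullet> frame_deriv (\<alpha> t0) (w t0) = 0"
    using vector_derivative_unique_at[OF _ has_vector_derivative_const] by force
  then show ?thesis
    using nil_connection_skew[of "frame_deriv (\<alpha> t0) v" "gauss_map (\<alpha> t0)" "frame_deriv (\<alpha> t0) (w t0)"]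
    by (simp add: second_form_def inner_diff_left inner_add_right)
qed

lemma frame_deriv_eq_0:
  assumes "p \<in> S2" "v \<in> tangent_S2 p" "frame_deriv p v = 0"
  shows "v = 0"
proof -
  have 0: "0 \<in> tangent_S2 p" by (simp add: tangent_S2_def)
  have "nil_coframe (f p) (sphere_deriv f p v) = nil_coframe (f p) 0"
    using assms(3) by (simp add: frame_deriv_def linear_0[OF linear_nil_coframe])
  then have "sphere_deriv f p v = 0" by (simp only: nil_coframe_inject)
  moreover have "sphere_deriv f p 0 = 0"
    using sphere_deriv_linear[OF smooth assms(1) 0 0, of 0 0] by simp
  ultimately show ?thesis
    using immersed assms(1,2) 0 inj_onD[of "sphere_deriv f p" "tangent_S2 p" v 0]
    unfolding immersed_sphere_def by simp
qed

lemma gram_pos_iff_independent: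
  assumes "p \<in> S2" "v \<in> tangent_S2 p" "w \<in> tangent_S2 p"
  shows "gram p v w > 0 \<longleftrightarrow> (\<forall>x y. x *\<^sub>R v + y *\<^sub>R w = 0 \<longrightarrow> x = 0 \<and> y = 0)"
proof
  let ?E = "frame_deriv p v \<bullet> frame_deriv p v" and ?F = "frame_deriv p v \<bullet> frame_deriv p w"
    and ?G = "frame_deriv p w \<bullet> frame_deriv p w"
  show "\<forall>x y. x *\<^sub>R v + y *\<^sub>R w = 0 \<longrightarrow> x = 0 \<and> y = 0" if pos: "gram p v w > 0"
  proof (intro allI impI)
    fix x y assume xy: "x *\<^sub>R v + y *\<^sub>R w = 0"
    have "x *\<^sub>R frame_deriv p v + y *\<^sub>R frame_deriv p w = frame_deriv p (0 *\<^sub>R v + 0 *\<^sub>R w)"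
      using frame_deriv_linear[OF assms, of x y] xy by simp
    also have "\<dots> = 0" unfolding frame_deriv_linear[OF assms] by simp
    finally have 0: "x *\<^sub>R frame_deriv p v + y *\<^sub>R frame_deriv p w = 0" .
    have "x * ?E + y * ?F = 0" "x * ?F + y * ?G = 0"
      using arg_cong[OF 0, of "\<lambda>z. frame_deriv p v \<bullet> z"] arg_cong[OF 0, of "\<lambda>z. frame_deriv p w \<bullet> z"]
      by (simp_all add: inner_add_right inner_commute)
    then have "x * (?E * ?G - ?F\<^sup>2) = 0" "y * (?E * ?G - ?F\<^sup>2) = 0" by algebra+
    then show "x = 0 \<and> y = 0" using pos by (simp add: gram_def)
  qed
  show "gram p v w > 0" if indep: "\<forall>x y. x *\<^sub>R v + y *\<^sub>R w = 0 \<longrightarrow> x = 0 \<and> y = 0"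
  proof -
    have "v \<noteq> 0" using indep[rule_format, of 1 0] by auto
    then have "frame_deriv p v \<noteq> 0" using frame_deriv_eq_0[OF assms(1,2)] by blast
    then have E: "?E > 0" by simp
    \<comment> \<open>\<open>u\<close> is \<open>E\<close> times the part of \<open>w\<close> orthogonal to \<open>v\<close>; its squared length is \<open>E\<close> times the
      Gram determinant.\<close>
    define u where "u = (- ?F) *\<^sub>R v + ?E *\<^sub>R w"
    have "u \<in> tangent_S2 p" using assms by (simp add: u_def tangent_S2_def inner_add_left inner_diff_left)
    moreover have "u \<noteq> 0" using indep[rule_format, of "- ?F" ?E] E by (auto simp: u_def)
    ultimately have "frame_deriv p u \<noteq> 0" using frame_deriv_eq_0[OF assms(1)] by blast
    then have "frame_deriv p u \<bullet> frame_deriv p u > 0" by simp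
    also have "frame_deriv p u \<bullet> frame_deriv p u = ?E * gram p v w"
      unfolding u_def frame_deriv_linear[OF assms] gram_def
      by (simp add: inner_add_left inner_add_right inner_diff_left inner_diff_right
          inner_commute[of "frame_deriv p w" "frame_deriv p v"] algebra_simps power2_eq_square)
    finally show ?thesis using E by (simp add: zero_less_mult_iff)
  qed
qed

text \<open>The trace of the shape operator in an arbitrary frame. Symmetry gives the orthonormal
  eigenbasis, so that principal curvatures exist, and the trace formula shows that their mean
  does not depend on the choice of eigenbasis; both are needed to evaluate the definite
  description.\<close>

theorem mean_curvature_eq:
  assumes p: "p \<in> S2" and v: "v \<in> tangent_S2 p" "w \<in> tangent_S2 p"
    and pos: "gram p v w > 0" and sym: "second_form p v w = second_form p w v"
  shows "mean_curvature f n p =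
     ((frame_deriv p v \<bullet> frame_deriv p v) * second_form p w w
      - 2 * (frame_deriv p v \<bullet> frame_deriv p w) * second_form p v w
      + (frame_deriv p w \<bullet> frame_deriv p w) * second_form p v v) / (2 * gram p v w)" (is "_ = ?H")
proof -
  let ?a1 = "frame_deriv p v" and ?a2 = "frame_deriv p w" and ?c1 = "shape p v" and ?c2 = "shape p w"
  note Dlin = frame_deriv_linear[OF p v] and Slin = shape_linear[OF p v]
  have Teq: "x *\<^sub>R v + y *\<^sub>R w \<in> tangent_S2 p" for x y
    using v by (simp add: tangent_S2_def inner_add_left)
  have eigen: "- covariant_deriv f n p u = k *\<^sub>R sphere_deriv f p u \<longleftrightarrow> shape p u = k *\<^sub>R frame_deriv p u" for u k
  proof -
    have "shape p u = nil_coframe (f p) (- covariant_deriv f n p u)"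
      by (simp add: shape_def linear_neg[OF linear_nil_coframe])
    moreover have "k *\<^sub>R frame_deriv p u = nil_coframe (f p) (k *\<^sub>R sphere_deriv f p u)"
      by (simp add: frame_deriv_def linear_scale[OF linear_nil_coframe])
    ultimately show ?thesis by (simp only: nil_coframe_inject)
  qed
  have indep: "x = 0 \<and> y = 0" if "x *\<^sub>R v + y *\<^sub>R w = 0" for x y
    using pos that gram_pos_iff_independent[OF p v] by blast
  have ex: "\<exists>k1 k2. principal_curvatures f n p k1 k2"
  proof -
    obtain a b c d k1 k2 where
      "(a *\<^sub>R ?a1 + b *\<^sub>R ?a2) \<bullet> (a *\<^sub>R ?a1 + b *\<^sub>R ?a2) = 1"
      "(c *\<^sub>R ?a1 + d *\<^sub>R ?a2) \<bullet> (c *\<^sub>R ?a1 + d *\<^sub>R ?a2) = 1"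
      "(a *\<^sub>R ?a1 + b *\<^sub>R ?a2) \<bullet> (c *\<^sub>R ?a1 + d *\<^sub>R ?a2) = 0"
      "a *\<^sub>R ?c1 + b *\<^sub>R ?c2 = k1 *\<^sub>R (a *\<^sub>R ?a1 + b *\<^sub>R ?a2)"
      "c *\<^sub>R ?c1 + d *\<^sub>R ?c2 = k2 *\<^sub>R (c *\<^sub>R ?a1 + d *\<^sub>R ?a2)"
      by (rule orthonormal_eigenbasis_exists[of ?a1 ?a2 ?c1 ?c2 "gauss_map p"])
         (use pos sym gauss_map_unit[OF p] gauss_map_normal[OF p] shape_tangential[OF p] v in
           \<open>auto simp: gram_def second_form_def inner_commute\<close>)
    then have "principal_curvatures f n p k1 k2"
      unfolding principal_curvatures_def nil_inner_frame_deriv eigen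
      by (intro bexI[of _ "a *\<^sub>R v + b *\<^sub>R w"] bexI[of _ "c *\<^sub>R v + d *\<^sub>R w"] Teq)
         (simp only: Dlin Slin)
    then show ?thesis by blast
  qed
  have uniq: "(k1 + k2) / 2 = ?H" if pc: "principal_curvatures f n p k1 k2" for k1 k2
  proof -
    obtain v1 v2 where vs: "v1 \<in> tangent_S2 p" "v2 \<in> tangent_S2 p"
      "frame_deriv p v1 \<bullet> frame_deriv p v1 = 1" "frame_deriv p v2 \<bullet> frame_deriv p v2 = 1"
      "frame_deriv p v1 \<bullet> frame_deriv p v2 = 0"
      "shape p v1 = k1 *\<^sub>R frame_deriv p v1" "shape p v2 = k2 *\<^sub>R frame_deriv p v2"
      using pc unfolding principal_curvatures_def nil_inner_frame_deriv eigen by blast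
    obtain a b where v1: "v1 = a *\<^sub>R v + b *\<^sub>R w"
      using tangent_S2_combination[OF p v vs(1) indep] by blast
    obtain c d where v2: "v2 = c *\<^sub>R v + d *\<^sub>R w"
      using tangent_S2_combination[OF p v vs(2) indep] by blast
    define E F G where EFG: "E = ?a1 \<bullet> ?a1" "F = ?a1 \<bullet> ?a2" "G = ?a2 \<bullet> ?a2"
    define L M N where LMN: "L = second_form p v v" "M = second_form p v w" "N = second_form p w w"
    note comm = inner_commute[of ?a2 ?a1]
    note tr = orthonormal_combinations_trace[of E a F b G c d]
    have 1: "E * a\<^sup>2 + 2 * F * a * b + G * b\<^sup>2 = 1" "E * c\<^sup>2 + 2 * F * c * d + G * d\<^sup>2 = 1"
      "E * a * c + F * (a * d + b * c) + G * b * d = 0"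
      using vs(3-5) unfolding v1 v2 Dlin
      by (simp_all add: inner_add_left inner_add_right comm EFG algebra_simps power2_eq_square)
    have k1: "k1 = L * a\<^sup>2 + 2 * M * a * b + N * b\<^sup>2"
    proof -
      have "k1 = shape p v1 \<bullet> frame_deriv p v1" using vs by simp
      then show ?thesis using sym unfolding v1 Dlin Slin LMN second_form_def
        by (simp add: inner_add_left inner_add_right algebra_simps power2_eq_square)
    qed
    have k2: "k2 = L * c\<^sup>2 + 2 * M * c * d + N * d\<^sup>2"
    proof -
      have "k2 = shape p v2 \<bullet> frame_deriv p v2" using vs by simp
      then show ?thesis using sym unfolding v2 Dlin Slin LMN second_form_def
        by (simp add: inner_add_left inner_add_right algebra_simps power2_eq_square)
    qed
    have g: "gram p v w = E * G - F\<^sup>2" by (simp add: gram_def EFG)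
    have "gram p v w * (k1 + k2) = L * (gram p v w * (a\<^sup>2 + c\<^sup>2)) + 2 * M * (gram p v w * (a * b + c * d))
        + N * (gram p v w * (b\<^sup>2 + d\<^sup>2))"
      unfolding k1 k2 by algebra
    also have "\<dots> = E * N - 2 * F * M + G * L"
      using tr[OF 1] unfolding g by simp
    finally show ?thesis using pos unfolding EFG LMN by (simp add: field_simps)
  qed
  show ?thesis
    unfolding mean_curvature_def
  proof (rule the_equality)
    show "\<exists>k1 k2. principal_curvatures f n p k1 k2 \<and> ?H = (k1 + k2) / 2"
      using ex uniq by metis
    show "H = ?H" if "\<exists>k1 k2. principal_curvatures f n p k1 k2 \<and> H = (k1 + k2) / 2" for H
      using that uniq by blast
  qed
qed

lemma continuous_on_gauss_map: "continuous_on S2 gauss_map"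
proof -
  note c = smooth_map_continuous_on[OF smooth] smooth_map_continuous_on[OF smooth_normal]
  have "continuous_on S2 (\<lambda>p. \<Sum>i\<in>UNIV. gauss_map p $ i *\<^sub>R axis i 1 :: real^3)"
    unfolding sum_3 gauss_map_def nil_coframe_nth by (intro continuous_intros c)
  then show ?thesis
    using basis_expansion[of "gauss_map _"] by (simp add: scalar_mult_eq_scaleR)
qed

lemma continuous_on_frame_deriv: "continuous_on S2 (\<lambda>p. frame_deriv p (tangent_part b p) $ i)"
proof -
  note c = smooth_map_continuous_on[OF smooth] continuous_on_sphere_deriv[OF smooth]
  have "continuous_on S2 (\<lambda>p. nil_coframe (f p) (sphere_deriv f p (tangent_part b p)) $ i)"
    using exhaust_3[of i] by (elim disjE; simp only: nil_coframe_nth; intro continuous_intros c)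
  then show ?thesis by (simp add: frame_deriv_def)
qed

lemma continuous_on_shape: "continuous_on S2 (\<lambda>p. shape p (tangent_part b p) $ i)"
proof -
  note c = smooth_map_continuous_on[OF smooth] smooth_map_continuous_on[OF smooth_normal]
    continuous_on_sphere_deriv[OF smooth] continuous_on_sphere_deriv[OF smooth_normal]
  show ?thesis
    unfolding shape_def nil_coframe_covariant_deriv using exhaust_3[of i]
    by (elim disjE; simp only: vector_minus_component vector_add_component vector_uminus_component
        nil_coframe_nth nil_connection_nth vector_3; intro continuous_intros c)
       auto
qed

lemma continuous_on_second_form:
  "continuous_on S2 (\<lambda>p. second_form p (tangent_part b p) (tangent_part c p))"
  unfolding second_form_def inner_vec3
  by (intro continuous_intros continuous_on_shape continuous_on_frame_deriv)

lemma continuous_on_first_form: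
  "continuous_on S2 (\<lambda>p. frame_deriv p (tangent_part b p) \<bullet> frame_deriv p (tangent_part c p))"
  unfolding inner_vec3 by (intro continuous_intros continuous_on_frame_deriv)

lemma tangent_S2_basis:
  assumes "p \<in> S2"
  obtains b c where "b \<in> tangent_S2 p" "c \<in> tangent_S2 p" "\<And>x y. x *\<^sub>R b + y *\<^sub>R c = 0 \<Longrightarrow> x = 0 \<and> y = 0"
proof -
  obtain B where B: "B \<subseteq> tangent_S2 p" "independent B" "card B = 2"
    using basis_exists[of "tangent_S2 p"] dim_tangent_S2[OF assms] by metis
  then obtain b c where bc: "B = {b, c}" "b \<noteq> c" by (auto simp: card_2_iff)
  have "x = 0 \<and> y = 0" if 0: "x *\<^sub>R b + y *\<^sub>R c = 0" for x y
  proof -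
    have "(\<Sum>v\<in>{b,c}. (if v = b then x else y) *\<^sub>R v) = 0" using 0 bc by simp
    note z = independentD[OF B(2)[unfolded bc(1)] _ subset_refl this]
    show ?thesis using z[of b] z[of c] bc(2) by simp
  qed
  then show thesis using that B bc by auto
qed

text \<open>Near a point \<open>p\<close>, project a basis of its tangent plane to the nearby tangent planes. The
  Gram determinant stays positive, and the trace formula is continuous.\<close>

theorem continuous_on_mean_curvature:
  assumes sym: "\<And>p v w. p \<in> S2 \<Longrightarrow> v \<in> tangent_S2 p \<Longrightarrow> w \<in> tangent_S2 p \<Longrightarrow>
    second_form p v w = second_form p w v"
  shows "continuous_on S2 (mean_curvature f n)"
  unfolding continuous_on_eq_continuous_within
proof
  fix p assume p: "p \<in> S2"
  obtain b c where bc: "b \<in> tangent_S2 p" "c \<in> tangent_S2 p" "\<And>x y. x *\<^sub>R b + y *\<^sub>R c = 0 \<Longrightarrow> x = 0 \<and> y = 0"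
    using tangent_S2_basis[OF p] by metis
  let ?v = "tangent_part b" and ?w = "tangent_part c"
  let ?g = "\<lambda>q. gram q (?v q) (?w q)"
  let ?H = "\<lambda>q. ((frame_deriv q (?v q) \<bullet> frame_deriv q (?v q)) * second_form q (?w q) (?w q)
      - 2 * (frame_deriv q (?v q) \<bullet> frame_deriv q (?w q)) * second_form q (?v q) (?w q)
      + (frame_deriv q (?w q) \<bullet> frame_deriv q (?w q)) * second_form q (?v q) (?v q)) / (2 * ?g q)"
  have g: "continuous_on S2 ?g"
    unfolding gram_def by (intro continuous_intros continuous_on_first_form)
  have gp: "?g p > 0"
    using bc gram_pos_iff_independent[OF p bc(1,2)] by (simp add: tangent_part_tangent)
  have ev: "\<forall>\<^sub>F q in at p within S2. ?g q > 0"
    using g p gp by (auto simp: continuous_on_def intro: order_tendstoD(1))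
  have eq: "?H q = mean_curvature f n q" if "q \<in> S2" "?g q > 0" for q
    using mean_curvature_eq[OF that(1) _ _ that(2)] tangent_part_in_tangent_S2[OF that(1)] sym[OF that(1)]
    by simp
  have cH: "continuous (at p within S2) ?H"
  proof -
    note first = continuous_on_first_form[unfolded continuous_on_eq_continuous_within, rule_format, OF p]
    note second = continuous_on_second_form[unfolded continuous_on_eq_continuous_within, rule_format, OF p]
    note gc = g[unfolded continuous_on_eq_continuous_within, rule_format, OF p]
    show ?thesis
      by (intro continuous_at_within_divide continuous_add continuous_diff continuous_mult continuous_const first second gc)
         (use gp in simp)
  qed
  have "\<forall>\<^sub>F q in at p within S2. ?H q = mean_curvature f n q"
    using ev unfolding eventually_at_filter by eventually_elim (use eq in auto)
  then show "continuous (at p within S2) (mean_curvature f n)"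
    using cH eq[OF p gp] by (simp add: continuous_within filterlim_cong[OF refl refl])
qed

end

section \<open>The energy of a profile curve\<close>

text \<open>A curve \<open>(x, y, h)\<close> in the coordinates \<open>h = z - x y / 2\<close>, with its first and second
  derivatives. Cartesian coordinates are chosen because the distance from the axis is not
  differentiable where the curve meets the axis.\<close>

locale profile_curve =
  fixes x y h x1 y1 h1 x2 y2 h2 :: "real \<Rightarrow> real"
  assumes x1: "(x has_real_derivative x1 s) (at s)" and x2: "(x1 has_real_derivative x2 s) (at s)"
    and y1: "(y has_real_derivative y1 s) (at s)" and y2: "(y1 has_real_derivative y2 s) (at s)"
    and h1: "(h has_real_derivative h1 s) (at s)" and h2: "(h1 has_real_derivative h2 s) (at s)"
begin

definition r where "r s = (x s)\<^sup>2 + (y s)\<^sup>2"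
definition r1 where "r1 s = 2 * (x s * x1 s + y s * y1 s)"
definition r2 where "r2 s = 2 * ((x1 s)\<^sup>2 + (y1 s)\<^sup>2 + x s * x2 s + y s * y2 s)"

text \<open>The area element of the surface of revolution is \<open>D ds d\<phi>\<close>.\<close>

definition D where "D s = sqrt (r s * (h1 s)\<^sup>2 + (1 + r s / 4) * (r1 s)\<^sup>2 / 4)"

text \<open>The mean curvature of the surface of revolution, for the normal in the direction of the cross
  product of the \<open>s\<close>- and \<open>\<phi>\<close>-derivatives.\<close>

definition H where
  "H s = (r s * (h1 s)^3 + (r1 s)\<^sup>2 * h1 s * (1 / 2 + r s / 16)
      + r s * (1 + r s / 4) * (h2 s * r1 s - h1 s * r2 s) / 2) / (2 * D s ^ 3)"

text \<open>On a sphere of constant mean curvature this is the mean curvature. With \<open>\<sigma>\<close> the angle of the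
  profile in the orbit space and \<open>\<rho> = \<surd>r\<close>, it is \<open>sin \<sigma> / \<rho>\<close>.\<close>

definition \<kappa> where "\<kappa> s = h1 s / D s"

definition T where "T s = - (1 + r s / 4) * r1 s / (2 * D s)"

lemma r_nonneg: "r s \<ge> 0" by (simp add: r_def)

lemma D_square: "(D s)\<^sup>2 = r s * (h1 s)\<^sup>2 + (1 + r s / 4) * (r1 s)\<^sup>2 / 4"
  using r_nonneg by (simp add: D_def)

lemma D_nonneg: "D s \<ge> 0" using r_nonneg by (simp add: D_def)

lemma DERIV_r: "(r has_real_derivative r1 s) (at s)"
  unfolding r_def[abs_def] r1_def by (auto intro!: derivative_eq_intros x1 y1)

lemma DERIV_r1: "(r1 has_real_derivative r2 s) (at s)"
  unfolding r1_def[abs_def] r2_def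
  by (auto intro!: derivative_eq_intros x1 y1 x2 y2 simp: algebra_simps power2_eq_square)

lemma continuous_D: "continuous_on S D"
proof -
  have "continuous_on S r" "continuous_on S r1" "continuous_on S h1"
    using DERIV_isCont[OF DERIV_r] DERIV_isCont[OF DERIV_r1] DERIV_isCont[OF h2]
    by (simp_all add: continuous_at_imp_continuous_on)
  then show ?thesis
    unfolding D_def[abs_def] by (intro continuous_intros) simp_all
qed

lemma r_pos: "D s > 0 \<Longrightarrow> r s > 0"
proof -
  assume "D s > 0"
  have "r s \<noteq> 0"
  proof
    assume "r s = 0"
    then have "x s = 0" "y s = 0" by (auto simp: r_def)
    then have "D s = 0" by (simp add: D_def r1_def r_def)
    with \<open>D s > 0\<close> show False by simp
  qed
  with r_nonneg[of s] show ?thesis by simp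
qed

definition D1 where
  "D1 s = (r1 s * (h1 s)\<^sup>2 + 2 * r s * h1 s * h2 s + (1 + r s / 4) * r1 s * r2 s / 2 + (r1 s)^3 / 16) / (2 * D s)"

lemma DERIV_D:
  assumes "D s > 0"
  shows "(D has_real_derivative D1 s) (at s)"
proof -
  have pos: "r s * (h1 s)\<^sup>2 + (1 + r s / 4) * (r1 s)\<^sup>2 / 4 > 0"
    using assms by (simp add: D_def)
  have "((\<lambda>s. r s * (h1 s)\<^sup>2 + (1 + r s / 4) * (r1 s)\<^sup>2 / 4) has_real_derivative
     (r1 s * (h1 s)\<^sup>2 + 2 * r s * h1 s * h2 s + (1 + r s / 4) * r1 s * r2 s / 2 + (r1 s)^3 / 16)) (at s)"
    by (auto intro!: derivative_eq_intros DERIV_r DERIV_r1 h2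
        simp: field_simps power2_eq_square power3_eq_cube)
  from DERIV_chain2[OF DERIV_real_sqrt[OF pos] this]
  show ?thesis unfolding D_def[abs_def] D1_def by (simp add: field_simps)
qed

text \<open>Equivalently \<open>(r \<kappa>)' = r' H\<close>: the flux \<open>r \<kappa>\<close> is the momentum conjugate to \<open>h\<close> in the
  area functional. Where \<open>r' = 0\<close> the relation does not determine \<open>H\<close>, hence the explicit
  formula in the definition of \<open>H\<close>.\<close>

lemma curvature_relation:
  assumes "D s > 0"
  obtains k where "(\<kappa> has_real_derivative k) (at s)" "r s * k = r1 s * (H s - \<kappa> s)"
proof -
  define k where "k = (h2 s * D s - h1 s * D1 s) / (D s * D s)"
  have "(\<kappa> has_real_derivative k) (at s)"
    unfolding \<kappa>_def[abs_def] k_def by (intro DERIV_divide h2 DERIV_D assms) (use assms in simp)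
  moreover have "r s * k = r1 s * (H s - \<kappa> s)"
  proof -
    define S where "S = r1 s * (h1 s)\<^sup>2 + 2 * r s * h1 s * h2 s + (1 + r s / 4) * r1 s * r2 s / 2 + (r1 s)^3 / 16"
    define N where "N = r s * (h1 s)^3 + (r1 s)\<^sup>2 * h1 s * (1 / 2 + r s / 16)
      + r s * (1 + r s / 4) * (h2 s * r1 s - h1 s * r2 s) / 2"
    have DD1: "2 * D s * D1 s = S" using assms by (simp add: D1_def S_def)
    have kD: "k * (D s * D s) = h2 s * D s - h1 s * D1 s" using assms by (simp add: k_def)
    have "2 * D s ^ 3 * (r s * k) = r s * (2 * D s * (k * (D s * D s)))"
      by (simp add: power3_eq_cube)
    also have "\<dots> = r s * (2 * h2 s * (D s)\<^sup>2 - h1 s * (2 * D s * D1 s))"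
      unfolding kD by (simp add: algebra_simps power2_eq_square)
    also note DD1
    finally have "2 * D s ^ 3 * (r s * k) = r s * (2 * h2 s * (D s)\<^sup>2 - h1 s * S)" .
    also have "\<dots> = r1 s * (N - 2 * h1 s * (D s)\<^sup>2)"
      unfolding D_square S_def N_def by (simp add: field_simps power2_eq_square power3_eq_cube)
    also have "\<dots> = 2 * D s ^ 3 * (r1 s * (H s - \<kappa> s))"
    proof -
      have N: "N = 2 * D s ^ 3 * H s" and h1: "h1 s = \<kappa> s * D s"
        using assms by (simp_all add: H_def \<kappa>_def N_def)
      show ?thesis unfolding N h1 by (simp add: algebra_simps power2_eq_square power3_eq_cube)
    qed
    finally show ?thesis using assms by simp
  qed
  ultimately show thesis by (rule that)
qed

text \<open>The completion of the square. Since \<open>H\<^sup>2 - (H - \<kappa>)\<^sup>2 = \<kappa> (2 H - \<kappa>)\<close> is linear in second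
  derivatives, it can be a derivative up to lower order terms, and \<open>n\<^sub>3\<^sup>2/4\<close> is exactly what is
  left over.\<close>

lemma DERIV_T:
  assumes "D s > 0"
  shows "(T has_real_derivative (H s)\<^sup>2 * D s - (r1 s)\<^sup>2 / (16 * D s) - (H s - \<kappa> s)\<^sup>2 * D s) (at s)"
proof -
  define S where "S = r1 s * (h1 s)\<^sup>2 + 2 * r s * h1 s * h2 s + (1 + r s / 4) * r1 s * r2 s / 2 + (r1 s)^3 / 16"
  define N where "N = r s * (h1 s)^3 + (r1 s)\<^sup>2 * h1 s * (1 / 2 + r s / 16)
      + r s * (1 + r s / 4) * (h2 s * r1 s - h1 s * r2 s) / 2"
  define num where "num = (- (r1 s / 4) * r1 s + - (1 + r s / 4) * r2 s)"
  have "(T has_real_derivative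
      (num * (2 * D s) - (- (1 + r s / 4) * r1 s) * (2 * D1 s)) / (2 * D s * (2 * D s))) (at s)"
    unfolding T_def[abs_def] num_def
    by (rule DERIV_divide)
       (use assms in \<open>auto intro!: derivative_eq_intros DERIV_r DERIV_r1 DERIV_D\<close>)
  moreover have "(num * (2 * D s) - (- (1 + r s / 4) * r1 s) * (2 * D1 s)) / (2 * D s * (2 * D s))
     = (H s)\<^sup>2 * D s - (r1 s)\<^sup>2 / (16 * D s) - (H s - \<kappa> s)\<^sup>2 * D s" (is "?l = ?r")
  proof -
    have DD1: "2 * D s * D1 s = S" using assms by (simp add: D1_def S_def)
    define A where "A = num * (2 * D s) - (- (1 + r s / 4) * r1 s) * (2 * D1 s)"
    define B where "B = 2 * D s * (2 * D s)"
    have B: "B \<noteq> 0" using assms by (simp add: B_def)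
    have "4 * D s ^ 3 * (A / B) = D s * (A / B * B)"
      unfolding B_def by (simp only: power3_eq_cube) (simp only: mult.assoc mult.commute mult.left_commute)
    also have "\<dots> = D s * A" using B by simp
    also have "\<dots> = 2 * num * (D s)\<^sup>2 + (1 + r s / 4) * r1 s * (2 * D s * D1 s)"
      by (simp add: A_def algebra_simps power2_eq_square)
    also note DD1
    finally have "4 * D s ^ 3 * ?l = 2 * num * (D s)\<^sup>2 + (1 + r s / 4) * r1 s * S"
      unfolding A_def B_def .
    also have "\<dots> = 4 * h1 s * N - 4 * (h1 s)\<^sup>2 * (D s)\<^sup>2 - (r1 s)\<^sup>2 * (D s)\<^sup>2 / 4"
      unfolding D_square S_def N_def num_def by (simp add: field_simps power2_eq_square power3_eq_cube)
    also have "\<dots> = 4 * D s ^ 3 * (h1 s * (2 * H s - \<kappa> s) - (r1 s)\<^sup>2 / (16 * D s))"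
    proof -
      define w where "w = (r1 s)\<^sup>2 / (16 * D s)"
      have w: "(r1 s)\<^sup>2 = 16 * D s * w" using assms by (simp add: w_def)
      have N: "N = 2 * D s ^ 3 * H s" and h1: "h1 s = \<kappa> s * D s"
        using assms by (simp_all add: H_def \<kappa>_def N_def)
      show ?thesis unfolding w_def[symmetric] w N h1
        by (simp add: algebra_simps power2_eq_square power3_eq_cube)
    qed
    also have "h1 s * (2 * H s - \<kappa> s) - (r1 s)\<^sup>2 / (16 * D s) = ?r"
      using assms by (simp add: \<kappa>_def field_simps power2_eq_square)
    finally have "4 * D s ^ 3 * ?l = 4 * D s ^ 3 * ?r" .
    moreover have "4 * D s ^ 3 \<noteq> 0" using assms by simp
    ultimately show ?thesis using mult_left_cancel by blast
  qed
  ultimately show ?thesis by (simp only:)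
qed

text \<open>At a pole \<open>r\<close> vanishes to second order and \<open>r'\<close> and \<open>D\<close> to first order. Dividing by powers
  of \<open>s - e\<close> leaves difference quotients with limits \<open>x1 e\<close> and \<open>y1 e\<close>. The sign
  \<open>\<bar>s - e\<bar> / (s - e)\<close> appears because \<open>D\<close> behaves like \<open>\<bar>s - e\<bar>\<close> and \<open>r'\<close> like \<open>s - e\<close>.\<close>

lemma T_limit:
  assumes e: "x e = 0" "y e = 0" "h1 e = 0" and m: "(x1 e)\<^sup>2 + (y1 e)\<^sup>2 > 0"
  shows "((\<lambda>s. T s * (\<bar>s - e\<bar> / (s - e))) \<longlongrightarrow> - 1) (at e)"
proof -
  let ?m = "(x1 e)\<^sup>2 + (y1 e)\<^sup>2"
  have qx: "((\<lambda>s. x s / (s - e)) \<longlongrightarrow> x1 e) (at e)" and qy: "((\<lambda>s. y s / (s - e)) \<longlongrightarrow> y1 e) (at e)"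
    using x1[of e] y1[of e] e by (simp_all add: has_field_derivative_iff)
  have c: "(x1 \<longlongrightarrow> x1 e) (at e)" "(y1 \<longlongrightarrow> y1 e) (at e)" "(h1 \<longlongrightarrow> 0) (at e)" "(r \<longlongrightarrow> 0) (at e)"
    using DERIV_isCont[OF x2] DERIV_isCont[OF y2] DERIV_isCont[OF h2, of e] DERIV_isCont[OF DERIV_r, of e] e
    by (simp_all add: isCont_def r_def)
  let ?R1 = "\<lambda>s. 2 * (x s / (s - e) * x1 s + y s / (s - e) * y1 s)"
  let ?R = "\<lambda>s. (x s / (s - e))\<^sup>2 + (y s / (s - e))\<^sup>2"
  let ?Q = "\<lambda>s. sqrt (?R s * (h1 s)\<^sup>2 + (1 + r s / 4) * (?R1 s)\<^sup>2 / 4)"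
  have R1: "(?R1 \<longlongrightarrow> 2 * (x1 e * x1 e + y1 e * y1 e)) (at e)"
    by (intro tendsto_intros qx qy c)
  have "(?Q \<longlongrightarrow> sqrt (((x1 e)\<^sup>2 + (y1 e)\<^sup>2) * 0\<^sup>2 + (1 + 0 / 4) * (2 * (x1 e * x1 e + y1 e * y1 e))\<^sup>2 / 4)) (at e)"
    by (intro tendsto_intros qx qy c R1) simp_all
  also have "(((x1 e)\<^sup>2 + (y1 e)\<^sup>2) * 0\<^sup>2 + (1 + 0 / 4) * (2 * (x1 e * x1 e + y1 e * y1 e))\<^sup>2 / 4) = ?m\<^sup>2"
    by (simp add: field_simps power2_eq_square)
  also have "sqrt (?m\<^sup>2) = ?m" using m by simp
  finally have Q: "(?Q \<longlongrightarrow> ?m) (at e)" .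
  have "((\<lambda>s. - (1 + r s / 4) * ?R1 s / (2 * ?Q s)) \<longlongrightarrow> - (1 + 0 / 4) * (2 * (x1 e * x1 e + y1 e * y1 e)) / (2 * ?m)) (at e)"
    by (intro tendsto_intros R1 Q c) (use m in simp_all)
  also have "- (1 + 0 / 4) * (2 * (x1 e * x1 e + y1 e * y1 e)) / (2 * ?m) = - 1"
    using m by (simp add: field_simps power2_eq_square)
  finally have lim: "((\<lambda>s. - (1 + r s / 4) * ?R1 s / (2 * ?Q s)) \<longlongrightarrow> - 1) (at e)" .
  have "- (1 + r s / 4) * ?R1 s / (2 * ?Q s) = T s * (\<bar>s - e\<bar> / (s - e))" if "s \<noteq> e" for s
  proof -
    define d where "d = s - e"
    have d: "d \<noteq> 0" using that by (simp add: d_def)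
    have R1: "?R1 s = r1 s / d"
      unfolding d_def[symmetric] by (simp add: r1_def add_divide_distrib)
    have R: "?R s = r s / d\<^sup>2"
      unfolding d_def[symmetric] by (simp add: r_def power_divide add_divide_distrib)
    have "?R s * (h1 s)\<^sup>2 + (1 + r s / 4) * (?R1 s)\<^sup>2 / 4 = (D s)\<^sup>2 / d\<^sup>2"
      unfolding R R1 D_square by (simp add: power_divide add_divide_distrib)
    then have Q: "?Q s = D s / \<bar>d\<bar>"
      using D_nonneg[of s] by (simp add: real_sqrt_divide)
    show ?thesis
      unfolding Q unfolding R1 unfolding T_def d_def[symmetric] by (simp add: mult.commute)
  qed
  then show ?thesis
    using lim by (subst (asm) tendsto_cong) (auto simp: eventually_at_filter)
qed

end

locale closed_profile = profile_curve +
  assumes poles: "x 0 = 0" "y 0 = 0" "h1 0 = 0" "x pi = 0" "y pi = 0" "h1 pi = 0"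
    and nondeg: "(x1 0)\<^sup>2 + (y1 0)\<^sup>2 > 0" "(x1 pi)\<^sup>2 + (y1 pi)\<^sup>2 > 0"
    and D_pos: "\<And>s. s \<in> {0<..<pi} \<Longrightarrow> D s > 0"
begin

definition T_closed where "T_closed s = (if s = 0 then - 1 else if s = pi then 1 else T s)"

lemma continuous_T_closed: "continuous_on {0..pi} T_closed"
  unfolding continuous_on_eq_continuous_within
proof
  fix s assume s: "s \<in> {0..pi}"
  consider "s = 0" | "s = pi" | "s \<in> {0<..<pi}" using s by force
  then show "continuous (at s within {0..pi}) T_closed"
  proof cases
    case 1
    have "((\<lambda>s. T s * (\<bar>s - 0\<bar> / (s - 0))) \<longlongrightarrow> - 1) (at 0 within {0..pi})"
      using T_limit[OF poles(1-3) nondeg(1)] tendsto_within_subset by blast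
    moreover have "\<forall>\<^sub>F s in at 0 within {0..pi}. T s * (\<bar>s - 0\<bar> / (s - 0)) = T_closed s"
      unfolding eventually_at using pi_gt_zero
      by (intro exI[of _ pi]) (auto simp: T_closed_def dist_real_def)
    ultimately have "(T_closed \<longlongrightarrow> - 1) (at 0 within {0..pi})" by (rule Lim_transform_eventually)
    moreover have "T_closed 0 = - 1" by (simp add: T_closed_def)
    ultimately show ?thesis using 1 by (simp add: continuous_within)
  next
    case 2
    have "((\<lambda>s. - (T s * (\<bar>s - pi\<bar> / (s - pi)))) \<longlongrightarrow> 1) (at pi within {0..pi})"
      using tendsto_minus[OF tendsto_within_subset[OF T_limit[OF poles(4-6) nondeg(2)] subset_UNIV]] by simp
    moreover have "\<forall>\<^sub>F s in at pi within {0..pi}. - (T s * (\<bar>s - pi\<bar> / (s - pi))) = T_closed s"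
      unfolding eventually_at using pi_gt_zero
      by (intro exI[of _ pi]) (auto simp: T_closed_def dist_real_def abs_if field_simps)
    ultimately have "(T_closed \<longlongrightarrow> 1) (at pi within {0..pi})" by (rule Lim_transform_eventually)
    moreover have "T_closed pi = 1" by (simp add: T_closed_def)
    ultimately show ?thesis using 2 by (simp add: continuous_within)
  next
    case 3
    have "isCont T s" using DERIV_isCont[OF DERIV_T[OF D_pos[OF 3]]] .
    moreover have "\<forall>\<^sub>F s in nhds s. s \<in> {0<..<pi}"
      using 3 by (intro eventually_nhds_in_open) auto
    then have "\<forall>\<^sub>F s in nhds s. T s = T_closed s"
      by eventually_elim (auto simp: T_closed_def)
    ultimately have "isCont T_closed s" by (simp add: isCont_cong)
    then show ?thesis by (rule continuous_at_imp_continuous_at_within)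
  qed
qed

text \<open>The boundary values of \<open>T\<close> contribute \<open>2\<close>. The formula for \<open>\<Phi>\<close> is assumed only
  between the poles, because \<open>D\<close> vanishes at them.\<close>

lemma has_integral_defect:
  assumes "continuous_on {0..pi} \<Phi>"
    and \<Phi>: "\<And>s. s \<in> {0<..<pi} \<Longrightarrow> \<Phi> s = (H s)\<^sup>2 * D s - (r1 s)\<^sup>2 / (16 * D s)"
  shows "((\<lambda>s. (H s - \<kappa> s)\<^sup>2 * D s) has_integral integral {0..pi} \<Phi> - 2) {0..pi}"
proof -
  let ?T' = "\<lambda>s. (H s)\<^sup>2 * D s - (r1 s)\<^sup>2 / (16 * D s) - (H s - \<kappa> s)\<^sup>2 * D s"
  have "(?T' has_integral T_closed pi - T_closed 0) {0..pi}"
  proof (rule fundamental_theorem_of_calculus_interior[OF _ continuous_T_closed])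
    show "(T_closed has_vector_derivative ?T' s) (at s)" if s: "s \<in> {0<..<pi}" for s
    proof -
      have "(T_closed has_real_derivative ?T' s) (at s)"
        by (rule has_field_derivative_transform_within_open[OF DERIV_T[OF D_pos[OF s]], of "{0<..<pi}"])
           (use s in \<open>auto simp: T_closed_def\<close>)
      then show ?thesis by (simp add: has_real_derivative_iff_has_vector_derivative)
    qed
  qed simp
  then have T': "(?T' has_integral 2) {0..pi}" using pi_gt_zero by (simp add: T_closed_def)
  have "(\<Phi> has_integral integral {0..pi} \<Phi>) {0..pi}"
    using assms(1) by (intro integrable_integral integrable_continuous_interval)
  from has_integral_diff[OF this T']
  show ?thesis
    by (rule has_integral_spike_finite[of "{0, pi}", rotated -1]) (use \<Phi> in auto)
qed

theorem profile_energy: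
  assumes \<Phi>c: "continuous_on {0..pi} \<Phi>"
    and \<Phi>: "\<And>s. s \<in> {0<..<pi} \<Longrightarrow> \<Phi> s = (H s)\<^sup>2 * D s - (r1 s)\<^sup>2 / (16 * D s)"
    and Hc: "continuous_on {0<..<pi} H"
  shows "integral {0..pi} \<Phi> \<ge> 2"
    and "integral {0..pi} \<Phi> = 2 \<longleftrightarrow> (\<exists>c. \<forall>s\<in>{0<..<pi}. H s = c)"
proof -
  let ?d = "\<lambda>s. (H s - \<kappa> s)\<^sup>2 * D s"
  note int = has_integral_defect[OF \<Phi>c \<Phi>]
  have nn: "?d s \<ge> 0" for s using D_nonneg by simp
  show "integral {0..pi} \<Phi> \<ge> 2"
    using has_integral_nonneg[OF int] nn by simp
  have "H s = \<kappa> s" if eq: "integral {0..pi} \<Phi> = 2" and s: "s \<in> {0<..<pi}" for s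
  proof -
    \<comment> \<open>The defect is continuous only between the poles, so a compact interval around \<open>s\<close> is
      used.\<close>
    define a b where "a = s / 2" "b = (s + pi) / 2"
    have ab: "0 < a" "a < s" "s < b" "b < pi" using s by (auto simp: a_b_def)
    have D: "continuous_on {a..b} D" by (rule continuous_D)
    have h1: "continuous_on {a..b} h1"
      by (rule DERIV_continuous_on[where D = h2]) (rule has_field_derivative_at_within[OF h2])
    have ne: "\<forall>t\<in>{a..b}. D t \<noteq> 0" using D_pos ab by (metis atLeastAtMost_iff greaterThanLessThan_iff less_irrefl less_le_trans le_less_trans)
    have sub: "{a..b} \<subseteq> {0<..<pi}" using ab by auto
    have c: "continuous_on {a..b} ?d"
      unfolding \<kappa>_def
      by (intro continuous_on_mult continuous_on_power continuous_on_diff continuous_on_divide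
          D h1 ne continuous_on_subset[OF Hc sub])
    have "integral {a..b} ?d \<le> integral {0..pi} ?d"
      by (rule integral_subset_le[OF _ integrable_continuous_interval[OF c] has_integral_integrable[OF int]])
         (use ab nn in auto)
    also have "\<dots> = 0" using integral_unique[OF int] eq by simp
    finally have "integral {a..b} ?d \<le> 0" .
    moreover have "integral {a..b} ?d \<ge> 0"
      by (rule integral_nonneg[OF integrable_continuous_interval[OF c]]) (rule nn)
    ultimately have "integral {a..b} ?d = 0" by (rule order_antisym)
    then have z: "(?d has_integral 0) (cbox a b)"
      using integrable_integral[OF integrable_continuous_interval[OF c]] unfolding cbox_interval by (simp only:)
    have "?d s = 0"
      by (rule has_integral_0_cbox_imp_0[OF c[folded cbox_interval] nn z]) (use ab in auto)
    then show ?thesis using D_pos[OF s] by simp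
  qed
  moreover have "\<exists>c. \<forall>s\<in>{0<..<pi}. \<kappa> s = c" if eq: "\<forall>s\<in>{0<..<pi}. H s = \<kappa> s"
  proof -
    have "(\<kappa> has_real_derivative 0) (at s)" if s: "s \<in> {0<..<pi}" for s
    proof -
      obtain k where "(\<kappa> has_real_derivative k) (at s)" "r s * k = r1 s * (H s - \<kappa> s)"
        using curvature_relation[OF D_pos[OF s]] .
      then show ?thesis using eq s r_pos[OF D_pos[OF s]] by simp
    qed
    then have "\<kappa> s = \<kappa> (pi / 2)" if "s \<in> {0<..<pi}" for s
      using DERIV_isconst3[of 0 pi s "pi / 2" \<kappa>] that pi_gt_zero by auto
    then show ?thesis by blast
  qed
  ultimately have 1: "\<exists>c. \<forall>s\<in>{0<..<pi}. H s = c" if "integral {0..pi} \<Phi> = 2"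
    using that by metis
  have 2: "integral {0..pi} \<Phi> = 2" if eq: "\<forall>s\<in>{0<..<pi}. H s = c" for c
  proof -
    let ?P = "\<lambda>s. r s * \<kappa> s - c * r s"
    have "(?P has_real_derivative 0) (at s)" if s: "s \<in> {0<..<pi}" for s
    proof -
      obtain k where k: "(\<kappa> has_real_derivative k) (at s)" "r s * k = r1 s * (H s - \<kappa> s)"
        using curvature_relation[OF D_pos[OF s]] .
      have "(?P has_real_derivative r1 s * \<kappa> s + k * r s - c * r1 s) (at s)"
        by (intro DERIV_diff DERIV_mult DERIV_cmult DERIV_r k)
      then show ?thesis using k(2) eq s by (simp add: algebra_simps)
    qed
    then have P: "?P s = ?P (pi / 2)" if "s \<in> {0<..<pi}" for s
      using DERIV_isconst3[of 0 pi s "pi / 2" ?P] that pi_gt_zero by auto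
    \<comment> \<open>From \<open>D\<^sup>2 \<ge> r h'\<^sup>2\<close>; this forces the constant \<open>r (\<kappa> - c)\<close> to vanish at the axis.\<close>
    have bound: "\<bar>?P s\<bar> \<le> sqrt (r s) + \<bar>c\<bar> * r s" if s: "s \<in> {0<..<pi}" for s
    proof -
      have "(r s * h1 s)\<^sup>2 \<le> r s * (D s)\<^sup>2"
        unfolding D_square using r_nonneg[of s] by (simp add: field_simps power2_eq_square)
      then have "sqrt ((r s * h1 s)\<^sup>2) \<le> sqrt (r s * (D s)\<^sup>2)" by (rule real_sqrt_le_mono)
      then have "\<bar>r s * h1 s\<bar> \<le> sqrt (r s) * D s"
        using D_nonneg[of s] by (simp add: real_sqrt_mult)
      then have "\<bar>r s * \<kappa> s\<bar> \<le> sqrt (r s)"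
        using D_pos[OF s] by (simp add: \<kappa>_def abs_mult field_simps)
      then show ?thesis using r_nonneg[of s] abs_triangle_ineq4[of "r s * \<kappa> s" "c * r s"]
        by (simp add: abs_mult)
    qed
    have "((\<lambda>s. sqrt (r s) + \<bar>c\<bar> * r s) \<longlongrightarrow> sqrt (r 0) + \<bar>c\<bar> * r 0) (at_right 0)"
      using DERIV_isCont[OF DERIV_r, of 0] unfolding isCont_def
      by (intro tendsto_intros) (auto intro: filterlim_mono at_le)
    moreover have "\<forall>\<^sub>F s in at_right 0. \<bar>?P (pi / 2)\<bar> \<le> sqrt (r s) + \<bar>c\<bar> * r s"
    proof -
      have "\<forall>\<^sub>F s in at_right 0. s \<in> {0<..<pi}"
        using pi_gt_zero by (rule eventually_at_right_real)
      then show ?thesis by eventually_elim (use P bound in metis)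
    qed
    ultimately have "\<bar>?P (pi / 2)\<bar> \<le> sqrt (r 0) + \<bar>c\<bar> * r 0"
      by (rule tendsto_lowerbound) simp
    moreover have "r 0 = 0" using poles by (simp add: r_def)
    ultimately have P0: "?P (pi / 2) = 0" by (simp only:) simp
    have "\<kappa> s = c" if "s \<in> {0<..<pi}" for s
    proof -
      have "r s * (\<kappa> s - c) = 0" using P[OF that] P0 by (simp only: algebra_simps)
      then show ?thesis using r_pos[OF D_pos[OF that]] by simp
    qed
    then have "((\<lambda>s. 0) has_integral integral {0..pi} \<Phi> - 2) {0..pi}"
      using eq by (intro has_integral_spike_finite[OF _ _ int, of "{0, pi}"]) auto
    then show ?thesis using has_integral_unique[OF has_integral_0] by fastforce
  qed
  show "integral {0..pi} \<Phi> = 2 \<longleftrightarrow> (\<exists>c. \<forall>s\<in>{0<..<pi}. H s = c)"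
    using 1 2 by blast
qed

end

section \<open>Rotations and spherical coordinates\<close>

definition rot1 :: "real \<Rightarrow> real \<Rightarrow> real \<Rightarrow> real" where "rot1 \<phi> u v = cos \<phi> * u - sin \<phi> * v"
definition rot2 :: "real \<Rightarrow> real \<Rightarrow> real \<Rightarrow> real" where "rot2 \<phi> u v = sin \<phi> * u + cos \<phi> * v"

lemma rot_dot: "rot1 \<phi> u v * rot1 \<phi> u' v' + rot2 \<phi> u v * rot2 \<phi> u' v' = u * u' + v * v'"
proof -
  have "rot1 \<phi> u v * rot1 \<phi> u' v' + rot2 \<phi> u v * rot2 \<phi> u' v'
     = ((sin \<phi>)\<^sup>2 + (cos \<phi>)\<^sup>2) * (u * u' + v * v')"
    unfolding rot1_def rot2_def by algebra
  then show ?thesis by (simp only: sin_cos_squared_add mult_1)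
qed

lemma DERIV_rot:
  "((\<lambda>\<phi>. rot1 \<phi> u v) has_real_derivative - rot2 \<phi> u v) (at \<phi>)"
  "((\<lambda>\<phi>. rot2 \<phi> u v) has_real_derivative rot1 \<phi> u v) (at \<phi>)"
  unfolding rot1_def[abs_def] rot2_def[abs_def] by (auto intro!: derivative_eq_intros)

lemma DERIV_rot_arg:
  assumes "(u has_real_derivative u') (at s)" "(v has_real_derivative v') (at s)"
  shows "((\<lambda>s. rot1 \<phi> (u s) (v s)) has_real_derivative rot1 \<phi> u' v') (at s)"
    "((\<lambda>s. rot2 \<phi> (u s) (v s)) has_real_derivative rot2 \<phi> u' v') (at s)"
  unfolding rot1_def[abs_def] rot2_def[abs_def] by (auto intro!: derivative_eq_intros assms)

definition meridian :: "real \<Rightarrow> real \<Rightarrow> real^3" where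
  "meridian s \<phi> = vector [cos s * cos \<phi>, cos s * sin \<phi>, - sin s]"

definition parallel :: "real \<Rightarrow> real \<Rightarrow> real^3" where
  "parallel s \<phi> = vector [- sin s * sin \<phi>, sin s * cos \<phi>, 0]"

lemma spherical_in_S2: "spherical s \<phi> \<in> S2"
proof -
  have "spherical s \<phi> \<bullet> spherical s \<phi> = (sin s)\<^sup>2 * ((sin \<phi>)\<^sup>2 + (cos \<phi>)\<^sup>2) + (cos s)\<^sup>2"
    unfolding spherical_def inner_vec3 vector_3 by algebra
  also have "\<dots> = 1" unfolding sin_cos_squared_add by simp
  finally show ?thesis by (simp add: norm_eq_sqrt_inner)
qed

lemma has_vector_derivative_vector_3:
  assumes "(f has_real_derivative f') (at t)" "(g has_real_derivative g') (at t)"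
    "(k has_real_derivative k') (at t)"
  shows "((\<lambda>t. vector [f t, g t, k t] :: real^3) has_vector_derivative vector [f', g', k']) (at t)"
proof (rule has_vector_derivative_vecI)
  show "((\<lambda>t. (vector [f t, g t, k t] :: real^3) $ i) has_real_derivative (vector [f', g', k'] :: real^3) $ i) (at t)"
    for i :: 3 using exhaust_3[of i] assms by auto
qed

lemma spherical_meridian: "((\<lambda>s. spherical s \<phi>) has_vector_derivative meridian s \<phi>) (at s)"
  unfolding spherical_def[abs_def] meridian_def
  by (intro has_vector_derivative_vector_3) (auto intro!: derivative_eq_intros)

lemma spherical_parallel: "((\<lambda>\<phi>. spherical s \<phi>) has_vector_derivative parallel s \<phi>) (at \<phi>)"
  unfolding spherical_def[abs_def] parallel_def
  by (intro has_vector_derivative_vector_3) (auto intro!: derivative_eq_intros)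

lemma meridian_tangent: "meridian s \<phi> \<in> tangent_S2 (spherical s \<phi>)"
  by (rule velocity_in_tangent_S2[OF spherical_in_S2 spherical_meridian])

lemma parallel_tangent: "parallel s \<phi> \<in> tangent_S2 (spherical s \<phi>)"
  by (rule velocity_in_tangent_S2[OF spherical_in_S2 spherical_parallel])

text \<open>Spherical coordinates are regular away from the poles.\<close>

lemma meridian_parallel_independent:
  assumes "sin s \<noteq> 0" "u *\<^sub>R meridian s \<phi> + v *\<^sub>R parallel s \<phi> = 0"
  shows "u = 0 \<and> v = 0"
proof -
  have "u * sin s = 0" and e: "u * (cos s * cos \<phi>) - v * (sin s * sin \<phi>) = 0"
    "u * (cos s * sin \<phi>) + v * (sin s * cos \<phi>) = 0"
    using assms(2) by (simp_all add: vec_eq_iff forall_3 meridian_def parallel_def)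
  then have u: "u = 0" using assms(1) by simp
  then have "v * sin \<phi> = 0" "v * cos \<phi> = 0" using e assms(1) by simp_all
  then have "v\<^sup>2 * ((sin \<phi>)\<^sup>2 + (cos \<phi>)\<^sup>2) = 0" by (simp only: distrib_left power_mult_distrib[symmetric]) simp
  then show ?thesis using u by simp
qed

lemma spherical_surj:
  assumes "p \<in> S2"
  obtains s \<phi> where "s \<in> {0..pi}" "p = spherical s \<phi>"
proof -
  have 1: "(p$1)\<^sup>2 + (p$2)\<^sup>2 + (p$3)\<^sup>2 = 1"
    using assms by (simp add: norm_eq_sqrt_inner inner_vec3 power2_eq_square)
  have le: "\<bar>p$3\<bar> \<le> 1" using 1 by (metis abs_square_le_1 le_add_same_cancel2 sum_power2_ge_zero)
  define s where "s = arccos (p$3)"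
  have s: "s \<in> {0..pi}" "cos s = p$3" using le by (auto simp: s_def arccos_lbound arccos_ubound abs_le_iff)
  have "sin s \<ge> 0" using s by (simp add: sin_ge_zero)
  have r: "(p$1)\<^sup>2 + (p$2)\<^sup>2 = (sin s)\<^sup>2"
    using 1 s(2) sin_cos_squared_add[of s] by simp
  obtain \<phi> where "p$1 = sin s * cos \<phi>" "p$2 = sin s * sin \<phi>"
  proof -
    obtain R t where "Complex (p$1) (p$2) = rcis R t" "R \<ge> 0"
      by (metis rcis_cmod_Arg norm_ge_zero)
    then have t: "p$1 = R * cos t" "p$2 = R * sin t"
      by (metis Re_rcis complex.sel(1), metis Im_rcis complex.sel(2))
    have "R\<^sup>2 * ((sin t)\<^sup>2 + (cos t)\<^sup>2) = (sin s)\<^sup>2"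
      unfolding r[symmetric] t by algebra
    then have "R\<^sup>2 = (sin s)\<^sup>2" by (simp only: sin_cos_squared_add mult_1_right)
    then have "R = sin s" using \<open>R \<ge> 0\<close> \<open>sin s \<ge> 0\<close> by (simp add: power2_eq_iff_nonneg)
    then show thesis using that t by blast
  qed
  then have "p = spherical s \<phi>" using s by (simp add: vec_eq_iff forall_3 spherical_def)
  then show thesis using that s by blast
qed

lemma continuous_on_spherical: "continuous_on S (\<lambda>(s, \<phi>). spherical s \<phi>)"
proof -
  have "continuous_on S (\<lambda>z. \<chi> i. spherical (fst z) (snd z) $ i)"
  proof (rule continuous_on_vec_lambda)
    fix i :: 3
    show "continuous_on S (\<lambda>z. spherical (fst z) (snd z) $ i)"
      using exhaust_3[of i] by (elim disjE; simp only: spherical_def vector_3; intro continuous_intros)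
  qed
  then show ?thesis by (simp add: case_prod_unfold)
qed

section \<open>Mean curvature of surfaces of revolution\<close>

text \<open>By the Lagrange identity a vector orthogonal to \<open>a\<close> and \<open>b\<close> is parallel to \<open>a \<times> b\<close>.\<close>

lemma unit_normal_cross3:
  fixes v a b :: "real^3"
  assumes "v \<bullet> v = 1" "v \<bullet> a = 0" "v \<bullet> b = 0" and N: "N = cross3 a b" "N \<bullet> N \<noteq> 0"
  shows "v = ((v \<bullet> N) / (N \<bullet> N)) *\<^sub>R N" and "(v \<bullet> N)\<^sup>2 = N \<bullet> N"
proof -
  define z where "z = v - ((v \<bullet> N) / (N \<bullet> N)) *\<^sub>R N"
  have N0: "N \<bullet> a = 0" "N \<bullet> b = 0" unfolding N by (simp_all add: dot_cross_self)
  have zN: "z \<bullet> N = 0" "z \<bullet> a = 0" "z \<bullet> b = 0"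
    using assms N0 by (simp_all add: z_def inner_diff_left)
  have "cross3 z N = 0" unfolding N Lagrange using zN by simp
  then have "(norm z * norm N)\<^sup>2 = 0" using norm_cross_dot[of z N] zN by simp
  then have "z = 0" using N(2) by simp
  then show v: "v = ((v \<bullet> N) / (N \<bullet> N)) *\<^sub>R N" by (simp add: z_def)
  have "v \<bullet> N = (v \<bullet> N) / (N \<bullet> N) * (N \<bullet> N)" using N(2) by simp
  have "1 = v \<bullet> (((v \<bullet> N) / (N \<bullet> N)) *\<^sub>R N)" using v assms(1) by simp
  also have "\<dots> = (v \<bullet> N)\<^sup>2 / (N \<bullet> N)" by (simp add: power2_eq_square)
  finally show "(v \<bullet> N)\<^sup>2 = N \<bullet> N" using N(2) by (simp add: field_simps)
qed

text \<open>The algebra of the mean curvature. \<open>As\<close> and \<open>Ap\<close> are the frame components of the \<open>s\<close>- and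
  \<open>\<phi>\<close>-derivatives of the surface at a point with horizontal coordinates \<open>(X, Y)\<close>. The results
  depend only on \<open>h\<close> and on the rotation invariant combinations \<open>r, r1, r2\<close>. The first identity
  gives the vertical component of the normal, the next two the area element, the fourth the
  symmetry of the second fundamental form, and the last the numerator of the trace formula for the unnormalized normal \<open>As \<times> Ap\<close>.\<close>

lemma revolution_polynomials:
  fixes X Y X1 Y1 X2 Y2 h1 h2 :: real
  defines "As \<equiv> vector [X1, Y1, h1 - (X * Y1 - Y * X1) / 2] :: real^3"
    and "Ap \<equiv> vector [- Y, X, - (X\<^sup>2 + Y\<^sup>2) / 2] :: real^3"
    and "r \<equiv> X\<^sup>2 + Y\<^sup>2" and "r1 \<equiv> 2 * (X * X1 + Y * Y1)"
    and "r2 \<equiv> 2 * (X1\<^sup>2 + Y1\<^sup>2 + X * X2 + Y * Y2)"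
  shows "cross3 As Ap $ 3 = r1 / 2"
    and "cross3 As Ap \<bullet> cross3 As Ap = r * h1\<^sup>2 + (1 + r / 4) * r1\<^sup>2 / 4"
    and "(As \<bullet> As) * (Ap \<bullet> Ap) - (As \<bullet> Ap)\<^sup>2 = r * h1\<^sup>2 + (1 + r / 4) * r1\<^sup>2 / 4"
    and "vector [- Y1, X1, - (X * X1 + Y * Y1)] + nil_connection As Ap
       = vector [- Y1, X1, 0] + nil_connection Ap As"
    and "(As \<bullet> As) * (cross3 As Ap \<bullet> (vector [- X, - Y, 0] + nil_connection Ap Ap))
       - 2 * (As \<bullet> Ap) * (cross3 As Ap \<bullet> (vector [- Y1, X1, - (X * X1 + Y * Y1)] + nil_connection As Ap))
       + (Ap \<bullet> Ap) * (cross3 As Ap \<bullet> (vector [X2, Y2, h2 - (X * Y2 - Y * X2) / 2] + nil_connection As As))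
       = r * h1 ^ 3 + r1\<^sup>2 * h1 * (1 / 2 + r / 16) + r * (1 + r / 4) * (h2 * r1 - h1 * r2) / 2"
proof -
  have N: "cross3 As Ap = vector [- X * h1 - Y * r1 / 4, - Y * h1 + X * r1 / 4, r1 / 2]"
    unfolding As_def Ap_def r1_def
    by (simp add: vec_eq_iff forall_3 cross3_def field_simps power2_eq_square)
  show "cross3 As Ap $ 3 = r1 / 2" by (simp add: N)
  show "cross3 As Ap \<bullet> cross3 As Ap = r * h1\<^sup>2 + (1 + r / 4) * r1\<^sup>2 / 4"
    unfolding N inner_vec3 r_def by (simp add: field_simps power2_eq_square)
  then show "(As \<bullet> As) * (Ap \<bullet> Ap) - (As \<bullet> Ap)\<^sup>2 = r * h1\<^sup>2 + (1 + r / 4) * r1\<^sup>2 / 4"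
    using norm_cross_dot[of As Ap] by (simp add: dot_square_norm power_mult_distrib)
  show "vector [- Y1, X1, - (X * X1 + Y * Y1)] + nil_connection As Ap
       = vector [- Y1, X1, 0] + nil_connection Ap As"
    unfolding As_def Ap_def
    by (simp add: vec_eq_iff forall_3 field_simps)
  define k where "k = h1 - (X * Y1 - Y * X1) / 2"
  define w where "w = X * Y1 - Y * X1"
  define u where "u = X * X1 + Y * Y1"
  define S where "S = X1\<^sup>2 + Y1\<^sup>2"
  define b where "b = X * X2 + Y * Y2"
  have r1: "r1 = 2 * u" by (simp add: r1_def u_def)
  have kw: "k = h1 - w / 2" by (simp add: k_def w_def)
  have r2: "r2 = 2 * (S + b)" by (simp add: r2_def S_def b_def)
  have c1: "As \<bullet> As = S + k\<^sup>2" "Ap \<bullet> Ap = r * (1 + r / 4)" "As \<bullet> Ap = w - k * r / 2"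
    unfolding As_def Ap_def inner_vec3 k_def[symmetric] r_def w_def S_def
    by (simp_all add: field_simps power2_eq_square)
  have c2: "cross3 As Ap \<bullet> (vector [- X, - Y, 0] + nil_connection Ap Ap) = (1 + r / 2) * (r * h1)"
    unfolding N unfolding Ap_def inner_vec3 r_def by (simp add: field_simps power2_eq_square)
  have c3: "cross3 As Ap \<bullet> (vector [X2, Y2, h2 - (X * Y2 - Y * X2) / 2] + nil_connection As As)
      = - h1 * b + u * h2 - k * (h1 * w + u\<^sup>2 / 2)"
    unfolding N r1 unfolding As_def inner_vec3 k_def[symmetric] w_def b_def u_def by (simp add: field_simps power2_eq_square)
  have c4: "cross3 As Ap \<bullet> (vector [- Y1, X1, - (X * X1 + Y * Y1)] + nil_connection As Ap)
      = h1 * w * (1 + r / 4) - h1 * k * r / 2 + r * u\<^sup>2 / 8"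
    unfolding N r1 unfolding As_def Ap_def inner_vec3 k_def[symmetric] w_def u_def r_def by (simp add: field_simps power2_eq_square)
  \<comment> \<open>The only relation among the invariants (the Lagrange identity in the plane).\<close>
  have rS: "r * S = u\<^sup>2 + w\<^sup>2"
    unfolding r_def S_def u_def w_def by algebra
  have "(S + k\<^sup>2) * ((1 + r / 2) * (r * h1))
       - 2 * (w - k * r / 2) * (h1 * w * (1 + r / 4) - h1 * k * r / 2 + r * u\<^sup>2 / 8)
       + r * (1 + r / 4) * (- h1 * b + u * h2 - k * (h1 * w + u\<^sup>2 / 2))
       - (r * h1 ^ 3 + r1\<^sup>2 * h1 * (1 / 2 + r / 16) + r * (1 + r / 4) * (h2 * r1 - h1 * r2) / 2)
     = h1 * (2 + 3 * r / 4) * (r * S - u\<^sup>2 - w\<^sup>2)"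
    unfolding r1 r2 kw by (simp add: field_simps power2_eq_square power3_eq_cube)
  then show "(As \<bullet> As) * (cross3 As Ap \<bullet> (vector [- X, - Y, 0] + nil_connection Ap Ap))
       - 2 * (As \<bullet> Ap) * (cross3 As Ap \<bullet> (vector [- Y1, X1, - (X * X1 + Y * Y1)] + nil_connection As Ap))
       + (Ap \<bullet> Ap) * (cross3 As Ap \<bullet> (vector [X2, Y2, h2 - (X * Y2 - Y * X2) / 2] + nil_connection As As))
       = r * h1 ^ 3 + r1\<^sup>2 * h1 * (1 / 2 + r / 16) + r * (1 + r / 4) * (h2 * r1 - h1 * r2) / 2"
    unfolding c1 c2 c3 c4 rS by simp
qed

text \<open>The frame components of a velocity do not involve the translation \<open>a\<close>: this is where left
  translates of surfaces of revolution are dealt with.\<close>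

lemma nil_coframe_velocity:
  assumes d: "(\<beta> has_vector_derivative d) (at t0)" and U: "open U" "t0 \<in> U"
    and \<beta>: "\<And>t. t \<in> U \<Longrightarrow> \<beta> t = nil_mult a (vector [u t, v t, k t + u t * v t / 2])"
    and u: "(u has_real_derivative u') (at t0)" and v: "(v has_real_derivative v') (at t0)"
    and k: "(k has_real_derivative k') (at t0)"
  shows "nil_coframe (\<beta> t0) d = vector [u', v', k' - (u t0 * v' - v t0 * u') / 2]"
proof -
  let ?g = "\<lambda>t. nil_mult a (vector [u t, v t, k t + u t * v t / 2])"
  have di: "((\<lambda>t. ?g t $ i) has_real_derivative d $ i) (at t0)" for i
    by (rule has_field_derivative_transform_within_open[OF has_vector_derivative_vec_nth[OF d] U])
       (simp add: \<beta>)
  have "((\<lambda>t. ?g t $ 1) has_real_derivative u') (at t0)"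
    unfolding nil_mult_def vector_3 by (auto intro!: derivative_eq_intros u)
  then have d1: "d $ 1 = u'" using DERIV_unique di by blast
  have "((\<lambda>t. ?g t $ 2) has_real_derivative v') (at t0)"
    unfolding nil_mult_def vector_3 by (auto intro!: derivative_eq_intros v)
  then have d2: "d $ 2 = v'" using DERIV_unique di by blast
  have "((\<lambda>t. ?g t $ 3) has_real_derivative k' + (u' * v t0 + u t0 * v') / 2 + a $ 1 * v') (at t0)"
    unfolding nil_mult_def vector_3 by (auto intro!: derivative_eq_intros u v k simp: mult.commute)
  then have d3: "d $ 3 = k' + (u' * v t0 + u t0 * v') / 2 + a $ 1 * v'" using DERIV_unique di by blast
  have "\<beta> t0 $ 1 = a $ 1 + u t0" using \<beta>[OF U(2)] by (simp add: nil_mult_def)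
  then show ?thesis
    by (simp add: vec_eq_iff forall_3 d1 d2 d3 field_simps)
qed

text \<open>The function \<open>h\<close> is invariant under rotations around the axis and \<open>(x, y)\<close> is turned by them,
  so the rotated curve has the displayed form before translation by \<open>a\<close>. Beyond \<open>[0, pi]\<close> the
  profile only serves to make derivatives at the poles two-sided.\<close>

locale revolution_sphere = nil_surface f n + profile_curve x y h x1 y1 h1 x2 y2 h2
  for f n x y h x1 y1 h1 x2 y2 h2 +
  fixes a :: "real^3"
  assumes rotational: "\<And>s \<phi>. s \<in> {0..pi} \<Longrightarrow> f (spherical s \<phi>) = nil_mult a (vector
    [rot1 \<phi> (x s) (y s), rot2 \<phi> (x s) (y s), h s + rot1 \<phi> (x s) (y s) * rot2 \<phi> (x s) (y s) / 2])"
begin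

definition "X s \<phi> = rot1 \<phi> (x s) (y s)"
definition "Y s \<phi> = rot2 \<phi> (x s) (y s)"
definition "X1 s \<phi> = rot1 \<phi> (x1 s) (y1 s)"
definition "Y1 s \<phi> = rot2 \<phi> (x1 s) (y1 s)"
definition "X2 s \<phi> = rot1 \<phi> (x2 s) (y2 s)"
definition "Y2 s \<phi> = rot2 \<phi> (x2 s) (y2 s)"

lemma DERIV_XY:
  "((\<lambda>s. X s \<phi>) has_real_derivative X1 s \<phi>) (at s)" "((\<lambda>s. Y s \<phi>) has_real_derivative Y1 s \<phi>) (at s)"
  "((\<lambda>s. X1 s \<phi>) has_real_derivative X2 s \<phi>) (at s)" "((\<lambda>s. Y1 s \<phi>) has_real_derivative Y2 s \<phi>) (at s)"
  "((\<lambda>\<phi>. X s \<phi>) has_real_derivative - Y s \<phi>) (at \<phi>)" "((\<lambda>\<phi>. Y s \<phi>) has_real_derivative X s \<phi>) (at \<phi>)"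
  "((\<lambda>\<phi>. X1 s \<phi>) has_real_derivative - Y1 s \<phi>) (at \<phi>)" "((\<lambda>\<phi>. Y1 s \<phi>) has_real_derivative X1 s \<phi>) (at \<phi>)"
  unfolding X_def Y_def X1_def Y1_def X2_def Y2_def
  by (intro DERIV_rot DERIV_rot_arg x1 x2 y1 y2)+

lemma rotation_invariants:
  "(X s \<phi>)\<^sup>2 + (Y s \<phi>)\<^sup>2 = r s" "2 * (X s \<phi> * X1 s \<phi> + Y s \<phi> * Y1 s \<phi>) = r1 s"
  "2 * ((X1 s \<phi>)\<^sup>2 + (Y1 s \<phi>)\<^sup>2 + X s \<phi> * X2 s \<phi> + Y s \<phi> * Y2 s \<phi>) = r2 s"
proof -
  have "(X1 s \<phi>)\<^sup>2 + (Y1 s \<phi>)\<^sup>2 + X s \<phi> * X2 s \<phi> + Y s \<phi> * Y2 s \<phi>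
    = (X1 s \<phi> * X1 s \<phi> + Y1 s \<phi> * Y1 s \<phi>) + (X s \<phi> * X2 s \<phi> + Y s \<phi> * Y2 s \<phi>)"
    by (simp add: power2_eq_square)
  then show "2 * ((X1 s \<phi>)\<^sup>2 + (Y1 s \<phi>)\<^sup>2 + X s \<phi> * X2 s \<phi> + Y s \<phi> * Y2 s \<phi>) = r2 s"
    by (simp only: X_def Y_def X1_def Y1_def X2_def Y2_def rot_dot r2_def power2_eq_square add.assoc)
qed (simp_all only: X_def Y_def X1_def Y1_def rot_dot r_def r1_def power2_eq_square)

text \<open>The frame components of the derivatives of the surface along meridians (\<open>Am\<close>) and parallels
  (\<open>Ap\<close>); see \<open>frame_meridian\<close> and \<open>frame_parallel\<close>.\<close>

definition Am :: "real \<Rightarrow> real \<Rightarrow> real^3" where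
  "Am s \<phi> = vector [X1 s \<phi>, Y1 s \<phi>, h1 s - (X s \<phi> * Y1 s \<phi> - Y s \<phi> * X1 s \<phi>) / 2]"

definition Ap :: "real \<Rightarrow> real \<Rightarrow> real^3" where
  "Ap s \<phi> = vector [- Y s \<phi>, X s \<phi>, - ((X s \<phi>)\<^sup>2 + (Y s \<phi>)\<^sup>2) / 2]"

lemma frame_meridian:
  assumes "s \<in> {0<..<pi}"
  shows "frame_deriv (spherical s \<phi>) (meridian s \<phi>) = Am s \<phi>"
  unfolding frame_deriv_def Am_def
  by (rule nil_coframe_velocity[where \<beta> = "\<lambda>s. f (spherical s \<phi>)" and u = "\<lambda>s. X s \<phi>" and v = "\<lambda>s. Y s \<phi>",
        OF sphere_deriv_chain[where \<alpha> = "\<lambda>s. spherical s \<phi>", OF smooth spherical_in_S2 spherical_meridian]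
        open_greaterThanLessThan assms _ DERIV_XY(1,2) h1])
     (simp add: rotational X_def Y_def)

lemma frame_parallel:
  assumes "s \<in> {0..pi}"
  shows "frame_deriv (spherical s \<phi>) (parallel s \<phi>) = Ap s \<phi>"
proof -
  have "nil_coframe (f (spherical s \<phi>)) (sphere_deriv f (spherical s \<phi>) (parallel s \<phi>))
      = vector [- Y s \<phi>, X s \<phi>, 0 - (X s \<phi> * X s \<phi> - Y s \<phi> * - Y s \<phi>) / 2]"
    by (rule nil_coframe_velocity[where \<beta> = "\<lambda>\<phi>. f (spherical s \<phi>)" and u = "\<lambda>\<phi>. X s \<phi>" and v = "\<lambda>\<phi>. Y s \<phi>"
          and k = "\<lambda>_. h s",
        OF sphere_deriv_chain[where \<alpha> = "\<lambda>\<phi>. spherical s \<phi>", OF smooth spherical_in_S2 spherical_parallel]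
        open_UNIV UNIV_I _ DERIV_XY(5,6) DERIV_const])
       (simp add: rotational[OF assms] X_def Y_def)
  also have "0 - (X s \<phi> * X s \<phi> - Y s \<phi> * - Y s \<phi>) / 2 = - ((X s \<phi>)\<^sup>2 + (Y s \<phi>)\<^sup>2) / 2"
    by (simp add: power2_eq_square field_simps)
  finally show ?thesis by (simp only: frame_deriv_def Ap_def)
qed

lemma moving_frame_identities:
  shows "cross3 (Am s \<phi>) (Ap s \<phi>) $ 3 = r1 s / 2"
    and "cross3 (Am s \<phi>) (Ap s \<phi>) \<bullet> cross3 (Am s \<phi>) (Ap s \<phi>) = (D s)\<^sup>2"
    and "(Am s \<phi> \<bullet> Am s \<phi>) * (Ap s \<phi> \<bullet> Ap s \<phi>) - (Am s \<phi> \<bullet> Ap s \<phi>)\<^sup>2 = (D s)\<^sup>2"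
    and "vector [- Y1 s \<phi>, X1 s \<phi>, - (X s \<phi> * X1 s \<phi> + Y s \<phi> * Y1 s \<phi>)] + nil_connection (Am s \<phi>) (Ap s \<phi>)
       = vector [- Y1 s \<phi>, X1 s \<phi>, 0] + nil_connection (Ap s \<phi>) (Am s \<phi>)"
    and "(Am s \<phi> \<bullet> Am s \<phi>) * (cross3 (Am s \<phi>) (Ap s \<phi>) \<bullet>
           (vector [- X s \<phi>, - Y s \<phi>, 0] + nil_connection (Ap s \<phi>) (Ap s \<phi>)))
       - 2 * (Am s \<phi> \<bullet> Ap s \<phi>) * (cross3 (Am s \<phi>) (Ap s \<phi>) \<bullet>
           (vector [- Y1 s \<phi>, X1 s \<phi>, - (X s \<phi> * X1 s \<phi> + Y s \<phi> * Y1 s \<phi>)] + nil_connection (Am s \<phi>) (Ap s \<phi>)))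
       + (Ap s \<phi> \<bullet> Ap s \<phi>) * (cross3 (Am s \<phi>) (Ap s \<phi>) \<bullet>
           (vector [X2 s \<phi>, Y2 s \<phi>, h2 s - (X s \<phi> * Y2 s \<phi> - Y s \<phi> * X2 s \<phi>) / 2] + nil_connection (Am s \<phi>) (Am s \<phi>)))
       = r s * h1 s ^ 3 + (r1 s)\<^sup>2 * h1 s * (1 / 2 + r s / 16)
           + r s * (1 + r s / 4) * (h2 s * r1 s - h1 s * r2 s) / 2"
  unfolding D_square rotation_invariants[of s \<phi>, symmetric] Am_def Ap_def by (rule revolution_polynomials)+

lemma gram_meridian_parallel:
  assumes "s \<in> {0<..<pi}"
  shows "gram (spherical s \<phi>) (meridian s \<phi>) (parallel s \<phi>) = (D s)\<^sup>2"
  unfolding gram_def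
  using moving_frame_identities(3)[where s = s and \<phi> = \<phi>] assms by (simp add: frame_meridian frame_parallel)

lemma gram_pos:
  assumes "s \<in> {0<..<pi}"
  shows "gram (spherical s \<phi>) (meridian s \<phi>) (parallel s \<phi>) > 0"
proof -
  have "sin s \<noteq> 0" using assms sin_gt_zero[of s] by auto
  then show ?thesis
    using gram_pos_iff_independent[OF spherical_in_S2 meridian_tangent parallel_tangent]
      meridian_parallel_independent by blast
qed

lemma D_pos_interior:
  assumes "s \<in> {0<..<pi}" shows "D s > 0"
proof -
  have "(D s)\<^sup>2 > 0" using gram_pos[OF assms] gram_meridian_parallel[OF assms] by simp
  then show ?thesis using D_nonneg[of s] by (simp add: order_le_less)
qed

lemma DERIV_Am_s:
  "((\<lambda>s. Am s \<phi>) has_vector_derivative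
      vector [X2 s \<phi>, Y2 s \<phi>, h2 s - (X s \<phi> * Y2 s \<phi> - Y s \<phi> * X2 s \<phi>) / 2]) (at s)"
  unfolding Am_def
  by (intro has_vector_derivative_vector_3) (auto intro!: derivative_eq_intros DERIV_XY h2)

lemma DERIV_Ap_s:
  "((\<lambda>s. Ap s \<phi>) has_vector_derivative
      vector [- Y1 s \<phi>, X1 s \<phi>, - (X s \<phi> * X1 s \<phi> + Y s \<phi> * Y1 s \<phi>)]) (at s)"
  unfolding Ap_def
  by (intro has_vector_derivative_vector_3) (auto intro!: derivative_eq_intros DERIV_XY)

lemma DERIV_Am_\<phi>:
  "((\<lambda>\<phi>. Am s \<phi>) has_vector_derivative vector [- Y1 s \<phi>, X1 s \<phi>, 0]) (at \<phi>)"
  unfolding Am_def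
  by (intro has_vector_derivative_vector_3) (auto intro!: derivative_eq_intros DERIV_XY)

lemma DERIV_Ap_\<phi>:
  "((\<lambda>\<phi>. Ap s \<phi>) has_vector_derivative vector [- X s \<phi>, - Y s \<phi>, 0]) (at \<phi>)"
  unfolding Ap_def
  by (intro has_vector_derivative_vector_3) (auto intro!: derivative_eq_intros DERIV_XY)

lemma second_forms:
  assumes s: "s \<in> {0<..<pi}"
  shows "second_form (spherical s \<phi>) (meridian s \<phi>) (meridian s \<phi>) = gauss_map (spherical s \<phi>) \<bullet>
      (vector [X2 s \<phi>, Y2 s \<phi>, h2 s - (X s \<phi> * Y2 s \<phi> - Y s \<phi> * X2 s \<phi>) / 2] + nil_connection (Am s \<phi>) (Am s \<phi>))"
    and "second_form (spherical s \<phi>) (meridian s \<phi>) (parallel s \<phi>) = gauss_map (spherical s \<phi>) \<bullet>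
      (vector [- Y1 s \<phi>, X1 s \<phi>, - (X s \<phi> * X1 s \<phi> + Y s \<phi> * Y1 s \<phi>)] + nil_connection (Am s \<phi>) (Ap s \<phi>))"
    and "second_form (spherical s \<phi>) (parallel s \<phi>) (meridian s \<phi>) = gauss_map (spherical s \<phi>) \<bullet>
      (vector [- Y1 s \<phi>, X1 s \<phi>, 0] + nil_connection (Ap s \<phi>) (Am s \<phi>))"
    and "second_form (spherical s \<phi>) (parallel s \<phi>) (parallel s \<phi>) = gauss_map (spherical s \<phi>) \<bullet>
      (vector [- X s \<phi>, - Y s \<phi>, 0] + nil_connection (Ap s \<phi>) (Ap s \<phi>))"
proof -
  have s': "s \<in> {0..pi}" using s by auto
  note fm = frame_meridian[OF s, of \<phi>] and fp = frame_parallel[OF s', of \<phi>]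
  note m = second_form_moving_frame[where \<alpha> = "\<lambda>s. spherical s \<phi>", OF spherical_in_S2 spherical_meridian]
    and p = second_form_moving_frame[where \<alpha> = "\<lambda>\<phi>. spherical s \<phi>", OF spherical_in_S2 spherical_parallel]
  note tr = has_vector_derivative_transform_within_open[OF _ open_greaterThanLessThan s]
  show "second_form (spherical s \<phi>) (meridian s \<phi>) (meridian s \<phi>) = gauss_map (spherical s \<phi>) \<bullet>
      (vector [X2 s \<phi>, Y2 s \<phi>, h2 s - (X s \<phi> * Y2 s \<phi> - Y s \<phi> * X2 s \<phi>) / 2] + nil_connection (Am s \<phi>) (Am s \<phi>))"
    using m[where w = "\<lambda>s. meridian s \<phi>", OF meridian_tangent tr[OF DERIV_Am_s]]
    by (simp add: frame_meridian fm)
  show "second_form (spherical s \<phi>) (meridian s \<phi>) (parallel s \<phi>) = gauss_map (spherical s \<phi>) \<bullet>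
      (vector [- Y1 s \<phi>, X1 s \<phi>, - (X s \<phi> * X1 s \<phi> + Y s \<phi> * Y1 s \<phi>)] + nil_connection (Am s \<phi>) (Ap s \<phi>))"
    using m[where w = "\<lambda>s. parallel s \<phi>", OF parallel_tangent tr[OF DERIV_Ap_s]]
    by (simp add: frame_parallel fm fp)
  show "second_form (spherical s \<phi>) (parallel s \<phi>) (meridian s \<phi>) = gauss_map (spherical s \<phi>) \<bullet>
      (vector [- Y1 s \<phi>, X1 s \<phi>, 0] + nil_connection (Ap s \<phi>) (Am s \<phi>))"
    using p[where w = "\<lambda>\<phi>. meridian s \<phi>", OF meridian_tangent, unfolded frame_meridian[OF s], OF DERIV_Am_\<phi>]
    by (simp only: fp)
  show "second_form (spherical s \<phi>) (parallel s \<phi>) (parallel s \<phi>) = gauss_map (spherical s \<phi>) \<bullet>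
      (vector [- X s \<phi>, - Y s \<phi>, 0] + nil_connection (Ap s \<phi>) (Ap s \<phi>))"
    using p[where w = "\<lambda>\<phi>. parallel s \<phi>", OF parallel_tangent, unfolded frame_parallel[OF s'], OF DERIV_Ap_\<phi>] .
qed

lemma second_form_commute_interior:
  assumes "s \<in> {0<..<pi}"
  shows "second_form (spherical s \<phi>) (meridian s \<phi>) (parallel s \<phi>)
    = second_form (spherical s \<phi>) (parallel s \<phi>) (meridian s \<phi>)"
  unfolding second_forms[OF assms] moving_frame_identities(4) ..

text \<open>The scalar product of the given unit normal with the coordinate normal; its sign tells whether
  the two agree.\<close>

definition orientation :: "real \<Rightarrow> real \<Rightarrow> real" where
  "orientation s \<phi> = gauss_map (spherical s \<phi>) \<bullet> cross3 (Am s \<phi>) (Ap s \<phi>)"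

lemma
  assumes s: "s \<in> {0<..<pi}"
  shows gauss_map_cross3: "gauss_map (spherical s \<phi>) = (orientation s \<phi> / (D s)\<^sup>2) *\<^sub>R cross3 (Am s \<phi>) (Ap s \<phi>)"
    and orientation_square: "(orientation s \<phi>)\<^sup>2 = (D s)\<^sup>2"
proof -
  let ?N = "cross3 (Am s \<phi>) (Ap s \<phi>)"
  have s': "s \<in> {0..pi}" using s by auto
  have N: "?N \<bullet> ?N = (D s)\<^sup>2"
    by (rule moving_frame_identities(2))
  have "?N \<bullet> ?N \<noteq> 0" using D_pos_interior[OF s] unfolding N by simp
  moreover have "gauss_map (spherical s \<phi>) \<bullet> Am s \<phi> = 0" "gauss_map (spherical s \<phi>) \<bullet> Ap s \<phi> = 0"
    using gauss_map_normal[OF spherical_in_S2 meridian_tangent, of s \<phi>]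
      gauss_map_normal[OF spherical_in_S2 parallel_tangent, of s \<phi>]
    by (simp_all add: frame_meridian[OF s] frame_parallel[OF s'])
  ultimately show "gauss_map (spherical s \<phi>) = (orientation s \<phi> / (D s)\<^sup>2) *\<^sub>R ?N"
    "(orientation s \<phi>)\<^sup>2 = (D s)\<^sup>2"
    using unit_normal_cross3[OF gauss_map_unit[OF spherical_in_S2] _ _ refl, of s \<phi> "Am s \<phi>" "Ap s \<phi>"]
    unfolding N orientation_def by blast+
qed

lemma mean_curvature_interior:
  assumes s: "s \<in> {0<..<pi}"
  shows "mean_curvature f n (spherical s \<phi>) = orientation s \<phi> / D s * H s"
proof -
  let ?N = "cross3 (Am s \<phi>) (Ap s \<phi>)" and ?\<nu> = "gauss_map (spherical s \<phi>)"
  let ?L = "vector [X2 s \<phi>, Y2 s \<phi>, h2 s - (X s \<phi> * Y2 s \<phi> - Y s \<phi> * X2 s \<phi>) / 2] + nil_connection (Am s \<phi>) (Am s \<phi>)"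
  let ?M = "vector [- Y1 s \<phi>, X1 s \<phi>, - (X s \<phi> * X1 s \<phi> + Y s \<phi> * Y1 s \<phi>)] + nil_connection (Am s \<phi>) (Ap s \<phi>)"
  let ?K = "vector [- X s \<phi>, - Y s \<phi>, 0] + nil_connection (Ap s \<phi>) (Ap s \<phi>)"
  define w where "w = orientation s \<phi> / (D s)\<^sup>2"
  have \<nu>: "?\<nu> \<bullet> z = w * (?N \<bullet> z)" for z
    unfolding w_def by (subst gauss_map_cross3[OF s]) simp
  have s': "s \<in> {0..pi}" using s by auto
  have "mean_curvature f n (spherical s \<phi>) =
     ((Am s \<phi> \<bullet> Am s \<phi>) * (?\<nu> \<bullet> ?K) - 2 * (Am s \<phi> \<bullet> Ap s \<phi>) * (?\<nu> \<bullet> ?M)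
       + (Ap s \<phi> \<bullet> Ap s \<phi>) * (?\<nu> \<bullet> ?L)) / (2 * (D s)\<^sup>2)"
    using mean_curvature_eq[OF spherical_in_S2 meridian_tangent parallel_tangent gram_pos[OF s]
        second_form_commute_interior[OF s]]
    unfolding second_forms[OF s] frame_meridian[OF s] frame_parallel[OF s'] gram_meridian_parallel[OF s] .
  also have "\<dots> = w * ((Am s \<phi> \<bullet> Am s \<phi>) * (?N \<bullet> ?K) - 2 * (Am s \<phi> \<bullet> Ap s \<phi>) * (?N \<bullet> ?M)
       + (Ap s \<phi> \<bullet> Ap s \<phi>) * (?N \<bullet> ?L)) / (2 * (D s)\<^sup>2)"
    unfolding \<nu> by (simp add: algebra_simps)
  also have "\<dots> = orientation s \<phi> / D s * H s"
    unfolding moving_frame_identities(5) H_def w_def using D_pos_interior[OF s]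
    by (simp add: power2_eq_square power3_eq_cube)
  finally show ?thesis .
qed

lemma normal_component_3:
  assumes s: "s \<in> {0<..<pi}"
  shows "gauss_map (spherical s \<phi>) $ 3 = orientation s \<phi> / D s * (r1 s / (2 * D s))"
  unfolding gauss_map_cross3[OF s] vector_scaleR_component moving_frame_identities(1)
  by (simp add: power2_eq_square)

end

section \<open>The spinor energy as an integral along the profile\<close>

text \<open>Poles are limits of other points on the same meridian.\<close>

lemma constant_up_to_poles:
  fixes g :: "real \<Rightarrow> real"
  assumes "continuous_on {0..pi} g" "\<And>t. t \<in> {0<..<pi} \<Longrightarrow> g t = c" "s \<in> {0..pi}"
  shows "g s = c"
  by (rule continuous_constant_on_closure[of "{0<..<pi}"]) (use assms in auto)

context revolution_sphere
begin

lemma second_form_bilinear: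
  assumes "p \<in> S2" "u \<in> tangent_S2 p" "v \<in> tangent_S2 p"
  shows "second_form p (k *\<^sub>R u + l *\<^sub>R v) (k' *\<^sub>R u + l' *\<^sub>R v) =
    k * k' * second_form p u u + k * l' * second_form p u v + l * k' * second_form p v u + l * l' * second_form p v v"
  unfolding second_form_def frame_deriv_linear[OF assms] shape_linear[OF assms]
  by (simp add: inner_add_left inner_add_right algebra_simps)

lemma second_form_sym_interior:
  assumes s: "s \<in> {0<..<pi}" and bc: "b \<in> tangent_S2 (spherical s \<phi>)" "c \<in> tangent_S2 (spherical s \<phi>)"
  shows "second_form (spherical s \<phi>) b c = second_form (spherical s \<phi>) c b"
proof -
  let ?m = "meridian s \<phi>" and ?p = "parallel s \<phi>"
  note T = spherical_in_S2[of s \<phi>] meridian_tangent[of s \<phi>] parallel_tangent[of s \<phi>]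
  have "sin s \<noteq> 0" using s sin_gt_zero[of s] by auto
  then have indep: "u = 0 \<and> v = 0" if "u *\<^sub>R ?m + v *\<^sub>R ?p = 0" for u v
    using meridian_parallel_independent that by blast
  obtain k l where b: "b = k *\<^sub>R ?m + l *\<^sub>R ?p"
    using tangent_S2_combination[OF T bc(1) indep] by blast
  obtain k' l' where c: "c = k' *\<^sub>R ?m + l' *\<^sub>R ?p"
    using tangent_S2_combination[OF T bc(2) indep] by blast
  show ?thesis
    unfolding b c second_form_bilinear[OF T] second_form_commute_interior[OF s] by (simp add: algebra_simps)
qed

lemma continuous_on_along_meridian:
  assumes "continuous_on S2 g" shows "continuous_on A (\<lambda>s. g (spherical s \<phi>))"
proof -
  have "continuous_on A (\<lambda>s. spherical s \<phi>)"
    by (rule continuous_at_imp_continuous_on)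
       (use has_vector_derivative_continuous[OF spherical_meridian] in blast)
  then show ?thesis
    by (rule continuous_on_compose2[OF assms]) (use spherical_in_S2 in auto)
qed

text \<open>At a pole the coordinate frame degenerates; the symmetry is inherited from nearby points by
  continuity.\<close>

lemma second_form_sym:
  assumes p: "p \<in> S2" and bc: "b \<in> tangent_S2 p" "c \<in> tangent_S2 p"
  shows "second_form p b c = second_form p c b"
proof -
  obtain s \<phi> where s: "s \<in> {0..pi}" "p = spherical s \<phi>" using spherical_surj[OF p] .
  define g where "g q = second_form q (tangent_part b q) (tangent_part c q)
      - second_form q (tangent_part c q) (tangent_part b q)" for q
  have "continuous_on S2 g"
    unfolding g_def by (intro continuous_intros continuous_on_second_form)
  then have "g (spherical s \<phi>) = 0"
    by (rule constant_up_to_poles[OF continuous_on_along_meridian _ s(1)])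
       (simp_all only: g_def second_form_sym_interior[OF _ tangent_part_in_tangent_S2 tangent_part_in_tangent_S2]
         spherical_in_S2 diff_self)
  then show ?thesis using bc unfolding s(2) g_def by (simp add: tangent_part_tangent)
qed

lemma continuous_mean_curvature: "continuous_on S2 (mean_curvature f n)"
  by (rule continuous_on_mean_curvature) (rule second_form_sym)

text \<open>The ratio is continuous on a connected set and takes only the values \<open>1\<close> and \<open>- 1\<close>. A single
  sign for the whole surface is what makes constancy of \<open>H\<close> and of the mean curvature
  equivalent.\<close>

lemma orientation_constant:
  obtains \<epsilon> where "\<epsilon> = 1 \<or> \<epsilon> = - 1"
    "\<And>s \<phi>. s \<in> {0<..<pi} \<Longrightarrow> orientation s \<phi> = \<epsilon> * D s"
proof -
  define Q where "Q = {0<..<pi} \<times> (UNIV :: real set)"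
  define e where "e = (\<lambda>(s, \<phi>). orientation s \<phi> / D s)"
  have cont: "continuous_on Q (\<lambda>z. u (fst z))" if "\<And>s. isCont u s" for u :: "real \<Rightarrow> real"
    by (rule continuous_on_compose2[OF continuous_at_imp_continuous_on[of UNIV]])
       (use that in \<open>auto intro!: continuous_intros\<close>)
  have xy: "continuous_on Q (\<lambda>z. x (fst z))" "continuous_on Q (\<lambda>z. y (fst z))"
    "continuous_on Q (\<lambda>z. x1 (fst z))" "continuous_on Q (\<lambda>z. y1 (fst z))" "continuous_on Q (\<lambda>z. h1 (fst z))"
    by (intro cont DERIV_isCont[OF x1] DERIV_isCont[OF y1] DERIV_isCont[OF x2] DERIV_isCont[OF y2] DERIV_isCont[OF h2])+
  have A: "continuous_on Q (\<lambda>z. X (fst z) (snd z))" "continuous_on Q (\<lambda>z. Y (fst z) (snd z))"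
    "continuous_on Q (\<lambda>z. X1 (fst z) (snd z))" "continuous_on Q (\<lambda>z. Y1 (fst z) (snd z))"
    unfolding X_def Y_def X1_def Y1_def rot1_def rot2_def
    by (intro continuous_intros xy)+
  have "continuous_on Q (\<lambda>z. gauss_map (spherical (fst z) (snd z)))"
    by (rule continuous_on_compose2[OF continuous_on_gauss_map
          continuous_on_spherical[of Q, unfolded case_prod_unfold]]) (use spherical_in_S2 in auto)
  moreover have "continuous_on Q (\<lambda>z. D (fst z))"
    by (rule continuous_on_compose2[OF continuous_D[of UNIV]]) (auto intro!: continuous_intros)
  moreover have "\<forall>z\<in>Q. D (fst z) \<noteq> 0"
    using D_pos_interior by (auto simp: Q_def) force
  ultimately have "continuous_on Q (\<lambda>z. orientation (fst z) (snd z) / D (fst z))"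
    unfolding orientation_def inner_vec3 cross_components Am_def Ap_def vector_3
    by (intro continuous_intros A xy) auto
  then have ce: "continuous_on Q e" by (simp add: e_def case_prod_unfold)
  have e1: "e z = 1 \<or> e z = - 1" if "z \<in> Q" for z
  proof -
    have "fst z \<in> {0<..<pi}" using that by (auto simp: Q_def)
    then have "(e z)\<^sup>2 = 1"
      using orientation_square[of "fst z" "snd z"] D_pos_interior[of "fst z"]
      by (simp add: e_def case_prod_unfold power_divide)
    then show ?thesis by (simp add: power2_eq_1_iff)
  qed
  have "connected Q" unfolding Q_def by (intro convex_connected convex_Times) auto
  moreover have "finite (e ` Q)"
    by (rule finite_subset[of _ "{1, - 1}"]) (use e1 in auto)
  ultimately have "e constant_on Q"
    using continuous_finite_range_constant[OF _ ce] by blast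
  then obtain \<epsilon> where \<epsilon>: "\<And>z. z \<in> Q \<Longrightarrow> e z = \<epsilon>" by (auto simp: constant_on_def)
  have "(pi / 2, 0) \<in> Q" by (simp add: Q_def)
  then have "\<epsilon> = 1 \<or> \<epsilon> = - 1" using e1 \<epsilon> by metis
  moreover have "orientation s \<phi> = \<epsilon> * D s" if "s \<in> {0<..<pi}" for s \<phi>
    using \<epsilon>[of "(s, \<phi>)"] that D_pos_interior[OF that] by (simp add: Q_def e_def field_simps)
  ultimately show thesis by (rule that)
qed

lemma area_density_eq:
  assumes s: "s \<in> {0<..<pi}"
  shows "area_density f s \<phi> = D s"
proof -
  have s': "s \<in> {0..pi}" using s by auto
  have 1: "vector_derivative (\<lambda>s'. f (spherical s' \<phi>)) (at s) = sphere_deriv f (spherical s \<phi>) (meridian s \<phi>)"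
    by (rule vector_derivative_at)
       (rule sphere_deriv_chain[where \<alpha> = "\<lambda>s. spherical s \<phi>", OF smooth spherical_in_S2 spherical_meridian])
  have 2: "vector_derivative (\<lambda>\<phi>'. f (spherical s \<phi>')) (at \<phi>) = sphere_deriv f (spherical s \<phi>) (parallel s \<phi>)"
    by (rule vector_derivative_at)
       (rule sphere_deriv_chain[where \<alpha> = "\<lambda>\<phi>. spherical s \<phi>", OF smooth spherical_in_S2 spherical_parallel])
  show ?thesis
    unfolding area_density_def Let_def 1 2 nil_inner_frame_deriv gram_def[symmetric]
      gram_meridian_parallel[OF s]
    using D_nonneg[of s] by simp
qed

definition energy_density :: "real^3 \<Rightarrow> real" where
  "energy_density p = (mean_curvature f n p)\<^sup>2 - (gauss_map p $ 3)\<^sup>2 / 4"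

lemma continuous_energy_density: "continuous_on S2 energy_density"
  unfolding energy_density_def[abs_def]
  by (intro continuous_intros continuous_mean_curvature continuous_on_gauss_map) simp

lemma energy_density_interior:
  assumes s: "s \<in> {0<..<pi}"
  shows "energy_density (spherical s \<phi>) = (H s)\<^sup>2 - (r1 s / (2 * D s))\<^sup>2 / 4"
proof -
  have "(orientation s \<phi> / D s)\<^sup>2 = 1"
    using orientation_square[OF s] D_pos_interior[OF s] by (simp add: power_divide)
  then show ?thesis
    unfolding energy_density_def mean_curvature_interior[OF s] normal_component_3[OF s] power_mult_distrib
    by simp
qed

text \<open>The integrand depends only on \<open>s\<close>, and it is continuous up to the poles; integration over
  \<open>\<phi>\<close> contributes \<open>2 pi\<close>.\<close>

lemma spinor_energy_eq:
  "spinor_energy f n = pi / 2 * integral {0..pi} (\<lambda>s. energy_density (spherical s 0) * D s)"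
proof -
  let ?\<Phi> = "\<lambda>s. energy_density (spherical s 0) * D s"
  let ?Q = "{0<..<pi} \<times> {0<..<2 * pi}"
  let ?M = "restrict_space (lborel :: (real \<times> real) measure) ?Q"
  let ?sph = "\<lambda>(s, \<phi>). spherical s \<phi>"
  let ?K = "cbox (0, 0) (pi, 2 * pi)"
  have Qbox: "?Q = box (0, 0) (pi, 2 * pi)" by (auto simp: box_def Basis_prod_def)
  have QM: "?Q \<inter> space lborel \<in> sets lborel" by (simp add: Qbox)
  have spM: "space ?M = ?Q" by (simp add: space_restrict_space)
  have c\<Phi>: "continuous_on A ?\<Phi>" for A
    by (intro continuous_intros continuous_on_along_meridian continuous_energy_density continuous_D)
  have c2: "continuous_on ?K (\<lambda>z. ?\<Phi> (fst z))"
    by (rule continuous_on_compose2[OF c\<Phi>[of UNIV]]) (simp_all add: continuous_on_fst)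
  have measT: "?sph \<in> measurable ?M (restrict_space borel S2)"
  proof (rule measurable_restrict_space2)
    show "?sph \<in> space ?M \<rightarrow> S2" using spherical_in_S2 by auto
    have "?sph \<in> borel_measurable borel"
      by (rule borel_measurable_continuous_onI) (rule continuous_on_spherical)
    then show "?sph \<in> borel_measurable ?M"
      by (intro measurable_restrict_space1) simp
  qed
  have measE: "energy_density \<in> borel_measurable (restrict_space borel S2)"
    by (rule borel_measurable_continuous_on_restrict[OF continuous_energy_density])
  have measD: "(\<lambda>z. D (fst z)) \<in> borel_measurable ?M"
  proof -
    have "continuous_on UNIV (\<lambda>z :: real \<times> real. D (fst z))"
      by (rule continuous_on_compose2[OF continuous_D[of UNIV]]) (auto intro!: continuous_intros)
    then have "(\<lambda>z :: real \<times> real. D (fst z)) \<in> borel_measurable borel" by (rule borel_measurable_continuous_onI)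
    then show ?thesis by (intro measurable_restrict_space1) simp
  qed
  have dens: "density ?M (\<lambda>(s, \<phi>). ennreal (area_density f s \<phi>)) = density ?M (\<lambda>z. ennreal (D (fst z)))"
  proof (rule density_cong)
    show m: "(\<lambda>z. ennreal (D (fst z))) \<in> borel_measurable ?M" using measD by measurable
    have "(\<lambda>(s, \<phi>). ennreal (area_density f s \<phi>)) \<in> borel_measurable ?M
      \<longleftrightarrow> (\<lambda>z. ennreal (D (fst z))) \<in> borel_measurable ?M"
      by (rule measurable_cong) (auto simp: spM area_density_eq)
    with m show "(\<lambda>(s, \<phi>). ennreal (area_density f s \<phi>)) \<in> borel_measurable ?M" by blast
    show "AE z in ?M. (case z of (s, \<phi>) \<Rightarrow> ennreal (area_density f s \<phi>)) = ennreal (D (fst z))"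
      by (rule AE_I2) (auto simp: spM area_density_eq)
  qed
  have "(LINT p|area_measure f. energy_density p)
     = (LINT z|density ?M (\<lambda>z. ennreal (D (fst z))). energy_density (?sph z))"
    unfolding area_measure_def dens
    by (rule integral_distr[OF _ measE]) (use measT in simp)
  also have "\<dots> = (LINT z|?M. D (fst z) *\<^sub>R energy_density (?sph z))"
    by (rule integral_density[OF measurable_compose[OF measT measE] measD]) (simp add: D_nonneg)
  also have "\<dots> = (LINT z|?M. ?\<Phi> (fst z))"
    by (rule Bochner_Integration.integral_cong[OF refl])
       (auto simp: spM energy_density_interior)
  also have "\<dots> = (LINT z:?Q|lborel. ?\<Phi> (fst z))"
    unfolding set_lebesgue_integral_def by (rule integral_restrict_space[OF QM])
  also have "\<dots> = integral ?Q (\<lambda>z. ?\<Phi> (fst z))"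
  proof (rule set_borel_integral_eq_integral(2))
    have "set_integrable lborel ?K (\<lambda>z. ?\<Phi> (fst z))"
      unfolding set_integrable_def
      by (rule borel_integrable_compact[OF compact_cbox c2])
    then show "set_integrable lborel ?Q (\<lambda>z. ?\<Phi> (fst z))"
      by (rule set_integrable_subset) (simp_all only: Qbox box_subset_cbox, simp)
  qed
  also have "\<dots> = integral ?K (\<lambda>z. ?\<Phi> (fst z))"
    unfolding Qbox by (rule integral_open_interval)
  also have "\<dots> = integral (cbox 0 pi) (\<lambda>s. integral (cbox 0 (2 * pi)) (\<lambda>\<phi>. ?\<Phi> s))"
    using integral_prod_continuous[OF c2] by simp
  also have "\<dots> = 2 * pi * integral {0..pi} ?\<Phi>"
  proof -
    have "integral (cbox 0 (2 * pi)) (\<lambda>\<phi>. ?\<Phi> s) = (2 * pi) * ?\<Phi> s" for s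
      by simp
    then show ?thesis by (simp only: cbox_interval integral_mult_right)
  qed
  finally have "(LINT p|area_measure f. energy_density p) = 2 * pi * integral {0..pi} ?\<Phi>" .
  moreover have "nil_inner (f p) (n p) (nil_frame 3 (f p)) = gauss_map p $ 3" for p
    by (simp add: nil_inner_coframe nil_frame_3 gauss_map_def inner_axis)
  ultimately show ?thesis
    by (simp add: spinor_energy_def energy_density_def)
qed

end

locale closed_revolution_sphere = revolution_sphere +
  assumes poles: "x 0 = 0" "y 0 = 0" "h1 0 = 0" "x pi = 0" "y pi = 0" "h1 pi = 0"
    and nondeg: "(x1 0)\<^sup>2 + (y1 0)\<^sup>2 > 0" "(x1 pi)\<^sup>2 + (y1 pi)\<^sup>2 > 0"

sublocale closed_revolution_sphere \<subseteq> closed_profile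
  by unfold_locales (rule poles nondeg D_pos_interior; assumption?)+

context closed_revolution_sphere
begin

theorem energy_bound:
  "spinor_energy f n \<ge> pi \<and> (spinor_energy f n = pi \<longleftrightarrow> constant_mean_curvature f n)"
proof -
  let ?\<Phi> = "\<lambda>s. energy_density (spherical s 0) * D s"
  obtain \<epsilon> where \<epsilon>: "\<epsilon> = 1 \<or> \<epsilon> = - 1"
    "\<And>s \<phi>. s \<in> {0<..<pi} \<Longrightarrow> orientation s \<phi> = \<epsilon> * D s"
    using orientation_constant by blast
  have mc: "mean_curvature f n (spherical s \<phi>) = \<epsilon> * H s" if "s \<in> {0<..<pi}" for s \<phi>
    using mean_curvature_interior[OF that] \<epsilon>(2)[OF that] D_pos_interior[OF that] by simp
  have Hmc: "H s = \<epsilon> * mean_curvature f n (spherical s \<phi>)" if "s \<in> {0<..<pi}" for s \<phi>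
    using mc[OF that, of \<phi>] \<epsilon>(1) by auto
  have \<Phi>c: "continuous_on {0..pi} ?\<Phi>"
    by (intro continuous_intros continuous_on_along_meridian continuous_energy_density continuous_D)
  have \<Phi>: "?\<Phi> s = (H s)\<^sup>2 * D s - (r1 s)\<^sup>2 / (16 * D s)" if "s \<in> {0<..<pi}" for s
    using D_pos_interior[OF that] by (simp add: energy_density_interior[OF that] field_simps power2_eq_square)
  have Hc: "continuous_on {0<..<pi} H"
    by (rule continuous_on_eq[where f = "\<lambda>s. \<epsilon> * mean_curvature f n (spherical s 0)"])
       (auto intro!: continuous_intros continuous_on_along_meridian continuous_mean_curvature simp: Hmc[symmetric])
  have const: "constant_mean_curvature f n \<longleftrightarrow> (\<exists>c. \<forall>s\<in>{0<..<pi}. H s = c)"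
  proof
    assume "constant_mean_curvature f n"
    then obtain c where "\<forall>p\<in>S2. mean_curvature f n p = c" by (auto simp: constant_mean_curvature_def)
    then show "\<exists>c. \<forall>s\<in>{0<..<pi}. H s = c" using Hmc spherical_in_S2 by (intro exI[of _ "\<epsilon> * c"]) metis
  next
    assume "\<exists>c. \<forall>s\<in>{0<..<pi}. H s = c"
    then obtain c where c: "\<And>s. s \<in> {0<..<pi} \<Longrightarrow> H s = c" by blast
    have "mean_curvature f n p = \<epsilon> * c" if "p \<in> S2" for p
    proof -
      obtain s \<phi> where s: "s \<in> {0..pi}" "p = spherical s \<phi>" using spherical_surj[OF \<open>p \<in> S2\<close>] .
      show ?thesis unfolding s(2)
        by (rule constant_up_to_poles[OF continuous_on_along_meridian[OF continuous_mean_curvature] _ s(1)])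
           (simp add: mc c)
    qed
    then show "constant_mean_curvature f n" by (auto simp: constant_mean_curvature_def)
  qed
  have E: "spinor_energy f n \<ge> pi \<longleftrightarrow> integral {0..pi} ?\<Phi> \<ge> 2"
    "spinor_energy f n = pi \<longleftrightarrow> integral {0..pi} ?\<Phi> = 2"
    unfolding spinor_energy_eq using pi_gt_zero by (simp_all add: field_simps)
  show ?thesis
    unfolding E const using profile_energy[OF \<Phi>c \<Phi> Hc] by blast
qed

end

section \<open>Spheres of revolution\<close>

text \<open>Used at the poles: passing through a pole, a meridian continues as the opposite meridian, and
  \<open>h\<close> takes the same values on both.\<close>

lemma DERIV_eq_0_of_reflection:
  fixes h :: "real \<Rightarrow> real"
  assumes h: "\<And>s. (h has_real_derivative h1 s) (at s)" and "\<delta> > 0"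
    and even: "\<And>s. s \<in> {0..\<delta>} \<Longrightarrow> h (e + s) = h (e - s)"
  shows "h1 e = 0"
proof -
  have "((\<lambda>s. h (e + s) - h (e - s)) has_real_derivative h1 (e + 0) * (0 + 1) - h1 (e - 0) * (0 - 1)) (at 0)"
    by (intro DERIV_diff DERIV_chain2[OF h] DERIV_add DERIV_const DERIV_ident)
  then have "((\<lambda>s. h (e + s) - h (e - s)) has_real_derivative 2 * h1 e) (at 0)" by simp
  then have "((\<lambda>s. 0) has_real_derivative 2 * h1 e) (at 0)"
  proof (rule has_field_derivative_transform_within_open)
    show "open {-\<delta><..<\<delta>}" "0 \<in> {-\<delta><..<\<delta>}" using \<open>\<delta> > 0\<close> by auto
    show "h (e + s) - h (e - s) = 0" if "s \<in> {-\<delta><..<\<delta>}" for s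
      using even[of s] even[of "- s"] that by (cases "s \<ge> 0") auto
  qed
  then show ?thesis using DERIV_unique[OF _ DERIV_const] by fastforce
qed

text \<open>Restricting the immersion to the full great circle \<open>s \<mapsto> spherical s 0\<close> gives a profile that is twice differentiable on
  the whole line and continues the generating curve beyond the poles. There \<open>x\<close> and \<open>y\<close> are odd and
  \<open>h\<close> is even, which gives \<open>x = y = h' = 0\<close> at the poles; the immersion condition then says that
  the curve leaves the axis with nonzero horizontal velocity.\<close>

theorem sphere_of_revolution_profile:
  assumes "sphere_of_revolution f" and "unit_normal f n"
  obtains x y h x1 y1 h1 x2 y2 h2 a where
    "closed_revolution_sphere f n x y h x1 y1 h1 x2 y2 h2 a"
proof -
  interpret nil_surface f n
    using assms by unfold_locales (simp_all add: sphere_of_revolution_def)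
  obtain a c where rot: "\<And>s \<phi>. s \<in> {0..pi} \<Longrightarrow> f (spherical s \<phi>) = nil_mult a (nil_rotation \<phi> (c s))"
    using assms(1) unfolding sphere_of_revolution_def by blast
  define u where "u s = f (spherical s 0)" for s
  define u1 where "u1 s = sphere_deriv f (spherical s 0) (meridian s 0)" for s
  define u2 where "u2 s = vector_derivative u1 (at s)" for s
  have u1: "(u has_vector_derivative u1 s) (at s)" for s
    unfolding u_def[abs_def] u1_def
    by (rule sphere_deriv_chain[where \<alpha> = "\<lambda>s. spherical s 0", OF smooth spherical_in_S2 spherical_meridian])
  have "((\<lambda>s. meridian s 0) has_vector_derivative vector [- sin s, 0, - cos s]) (at s)" for s
    unfolding meridian_def
    by (intro has_vector_derivative_vector_3) (auto intro!: derivative_eq_intros)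
  then have "(\<lambda>s. meridian s 0) differentiable (at s)" for s
    unfolding has_vector_derivative_def differentiable_def by blast
  then have "u1 differentiable (at s)" for s
    unfolding u1_def[abs_def]
    by (rule sphere_deriv_differentiable[where \<alpha> = "\<lambda>s. spherical s 0", OF smooth spherical_in_S2 spherical_meridian])
  then have u2: "(u1 has_vector_derivative u2 s) (at s)" for s
    unfolding u2_def by (simp add: vector_derivative_works)
  note du = has_vector_derivative_vec_nth[OF u1] has_vector_derivative_vec_nth[OF u2]
  define x where "x s = u s $ 1 - a $ 1" for s
  define y where "y s = u s $ 2 - a $ 2" for s
  define h where "h s = u s $ 3 - a $ 3 - a $ 1 * y s - x s * y s / 2" for s
  define x1 where "x1 s = u1 s $ 1" for s
  define y1 where "y1 s = u1 s $ 2" for s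
  define h1 where "h1 s = u1 s $ 3 - a $ 1 * y1 s - (x1 s * y s + x s * y1 s) / 2" for s
  define x2 where "x2 s = u2 s $ 1" for s
  define y2 where "y2 s = u2 s $ 2" for s
  define h2 where "h2 s = u2 s $ 3 - a $ 1 * y2 s - (x2 s * y s + 2 * x1 s * y1 s + x s * y2 s) / 2" for s
  have dx: "(x has_real_derivative x1 s) (at s)" and dy: "(y has_real_derivative y1 s) (at s)" for s
    unfolding x_def[abs_def] y_def[abs_def] x1_def y1_def by (auto intro!: derivative_eq_intros du)
  have dx1: "(x1 has_real_derivative x2 s) (at s)" and dy1: "(y1 has_real_derivative y2 s) (at s)" for s
    unfolding x1_def[abs_def] y1_def[abs_def] x2_def y2_def by (auto intro!: derivative_eq_intros du)
  have dh: "(h has_real_derivative h1 s) (at s)" for s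
    unfolding h_def[abs_def] h1_def
    by (auto intro!: derivative_eq_intros du dx dy simp: field_simps)
  have dh1: "(h1 has_real_derivative h2 s) (at s)" for s
    unfolding h1_def[abs_def] h2_def
    by (auto intro!: derivative_eq_intros du dx dy dx1 dy1 simp: field_simps)
  have u: "u s = nil_mult a (vector [x s, y s, h s + x s * y s / 2])" for s
    by (simp add: nil_mult_def vec_eq_iff forall_3 x_def y_def h_def)
  have profile: "x s = c s $ 1" "y s = c s $ 2" "h s = c s $ 3 - c s $ 1 * c s $ 2 / 2" if "s \<in> {0..pi}" for s
    using rot[OF that, of 0] unfolding x_def y_def h_def u_def
    by (simp_all add: nil_mult_def nil_rotation_def Let_def)
  have rotational: "f (spherical s \<phi>) = nil_mult a (vector
      [rot1 \<phi> (x s) (y s), rot2 \<phi> (x s) (y s), h s + rot1 \<phi> (x s) (y s) * rot2 \<phi> (x s) (y s) / 2])"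
    if "s \<in> {0..pi}" for s \<phi>
    using rot[OF that, of \<phi>] profile[OF that]
    by (simp add: nil_rotation_def Let_def rot1_def rot2_def)
  have opposite: "x t = - x s" "y t = - y s" "h t = h s"
    if "s \<in> {0..pi}" and t: "spherical t 0 = spherical s pi" for s t
  proof -
    have *: "u t = nil_mult a (vector [- x s, - y s, h s + x s * y s / 2])"
      unfolding u_def t rotational[OF that(1)] by (simp add: rot1_def rot2_def)
    show "x t = - x s" "y t = - y s" unfolding x_def y_def * by (simp_all add: nil_mult_def x_def y_def)
    then show "h t = h s" unfolding h_def[of t] * by (simp add: nil_mult_def)
  qed
  have reflect: "spherical (0 - s) 0 = spherical s pi" "spherical (pi + s) 0 = spherical (pi - s) pi" for s
    by (simp_all add: spherical_def vec_eq_iff forall_3)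
  have pole: "x 0 = 0" "y 0 = 0" "x pi = 0" "y pi = 0"
    using opposite(1,2)[of 0 0] opposite(1,2)[of pi pi] reflect[of 0] by simp_all
  have h0: "h1 0 = 0"
    by (rule DERIV_eq_0_of_reflection[OF dh pi_gt_zero]) (use opposite(3) reflect(1) in simp)
  have hpi: "h1 pi = 0"
  proof (rule DERIV_eq_0_of_reflection[OF dh pi_gt_zero])
    show "h (pi + s) = h (pi - s)" if "s \<in> {0..pi}" for s
      by (rule opposite(3)[OF _ reflect(2)]) (use that in auto)
  qed
  have frame: "frame_deriv (spherical e 0) (meridian e 0) = vector [x1 e, y1 e, h1 e - (x e * y1 e - y e * x1 e) / 2]" for e
    unfolding frame_deriv_def u1_def[symmetric]
    using nil_coframe_velocity[OF u1 open_UNIV UNIV_I u dx dy dh] by (simp add: u_def)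
  have nondeg: "(x1 e)\<^sup>2 + (y1 e)\<^sup>2 > 0" if "x e = 0" "y e = 0" "h1 e = 0" "cos e \<noteq> 0" for e
  proof -
    have "meridian e 0 \<noteq> 0" using that(4) by (auto simp: vec_eq_iff forall_3 meridian_def)
    then have "frame_deriv (spherical e 0) (meridian e 0) \<noteq> 0"
      using frame_deriv_eq_0[OF spherical_in_S2 meridian_tangent] by blast
    then have "x1 e \<noteq> 0 \<or> y1 e \<noteq> 0" unfolding frame using that by (auto simp: vec_eq_iff forall_3)
    then show ?thesis by (simp add: sum_power2_gt_zero_iff)
  qed
  have "closed_revolution_sphere f n x y h x1 y1 h1 x2 y2 h2 a"
    by unfold_locales
       (rule dx dy dh dx1 dy1 dh1 pole h0 hpi rotational; assumption?
        | (rule nondeg; simp add: pole h0 hpi))+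
  then show thesis by (rule that)
qed

theorem corollary1:
  fixes f n :: "real^3 \<Rightarrow> real^3"
  assumes "sphere_of_revolution f"
    and "unit_normal f n"
  shows "spinor_energy f n \<ge> pi \<and> (spinor_energy f n = pi \<longleftrightarrow> constant_mean_curvature f n)"
proof -
  obtain x y h x1 y1 h1 x2 y2 h2 a where "closed_revolution_sphere f n x y h x1 y1 h1 x2 y2 h2 a"
    by (rule sphere_of_revolution_profile[OF assms])
  then show ?thesis by (rule closed_revolution_sphere.energy_bound)
qed

end
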